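(* Let $\nu=\frac{1}{18}\sqrt{\frac{\pi}{2}}$. There is an absolute constant $C>0$ such that the following holds. Let $s\ge1$ and let $\bar x\in\mathbb{R}^n$ have sparse gradient, $|\mathrm{supp}(\nabla\bar x)|=s$, with separation constant $\Delta>0$ verifying $\Delta\ge 8s/n$. Let $A:\mathbb{R}^n\to\mathbb{R}^m$ be a Gaussian map with i.i.d. $\mathcal N(0,1/m)$ entries such that $$m\ \ge\ \frac{C}{\Delta}\,s\log(n)^2 .$$ Then with probability at least $1-3e^{-\nu^2m/16}$, the recovery of $\bar x$ (up to a global sign) is exact by solving $$\inf_{x\in\mathbb{R}^n}\|\nabla x\|_1\quad\text{subject to}\quad |Ax|=\sqrt{\bar y},\qquad \bar y=|A\bar x|^2,$$ i.e. the set of minimizers of this problem equals $\{\bar x,-\bar x\}$.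
   Context: For vectors, $|\cdot|$, squares and square roots are componentwise. $\nabla:\mathbb{R}^n\to\mathbb{R}^{n-1}$ is the discrete gradient, $(\nabla x)[i]=x[i+1]-x[i]$ for $i=1,\dots,n-1$. Writing $\mathrm{supp}(\nabla\bar x)=\{i_1,\dots,i_s\}$ with $0=i_0<i_1<\dots<i_s<i_{s+1}=n$, $\bar x$ has separation constant $\Delta>0$ if $$\min_{j\in\{1,\dots,s+1\}}\frac{|i_j-i_{j-1}|}{n}\ \ge\ \frac{\Delta}{s+1}.$$ *)

theory Defs
  imports "HOL-Probability.Probability" "Jordan_Normal_Form.Matrix"
begin

unbundle no vec_syntax

text \<open>Vectors of \<open>\<real>\<^sup>n\<close> are elements of \<open>carrier_vec n\<close>, so their components are indexed
  from \<open>0\<close>; the supports below are shifted by one so that they are subsets of \<open>{1..n}\<close>.\<close>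

definition nu :: real where
  "nu = 1 / 18 * sqrt (pi / 2)"

definition discrete_grad :: "real vec \<Rightarrow> real vec" where
  "discrete_grad x = vec (dim_vec x - 1) (\<lambda>i. x $ (i + 1) - x $ i)"

definition l1_norm :: "real vec \<Rightarrow> real" where
  "l1_norm v = (\<Sum>i<dim_vec v. \<bar>v $ i\<bar>)"

definition supp :: "real vec \<Rightarrow> nat set" where
  "supp v = {i \<in> {1..dim_vec v}. v $ (i - 1) \<noteq> 0}"

text \<open>The points \<open>0 = i\<^sub>0 < i\<^sub>1 < \<dots> < i\<^sub>s < i\<^sub>s\<^sub>+\<^sub>1 = n\<close>, as a list of length \<open>s + 2\<close>.\<close>

definition jump_list :: "real vec \<Rightarrow> nat list" where
  "jump_list x = 0 # sorted_list_of_set (supp (discrete_grad x)) @ [dim_vec x]"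

definition has_separation_constant :: "real vec \<Rightarrow> real \<Rightarrow> bool" where
  "has_separation_constant x \<Delta> \<longleftrightarrow> \<Delta> > 0 \<and>
    (let s = card (supp (discrete_grad x)); i = (\<lambda>j. real (jump_list x ! j))
     in (MIN j \<in> {1..s + 1}. \<bar>i j - i (j - 1)\<bar> / real (dim_vec x)) \<ge> \<Delta> / real (s + 1))"

text \<open>The law of the family of entries of a random \<open>m \<times> n\<close> matrix with independent
  \<open>\<N>(0, 1/m)\<close> entries; \<open>normal_density\<close> takes the standard deviation as its parameter.
  An outcome \<open>\<omega>\<close> is turned into the actual matrix by \<open>mat m n \<omega>\<close>.\<close>

definition gaussian_entries :: "nat \<Rightarrow> nat \<Rightarrow> (nat \<times> nat \<Rightarrow> real) measure" where
  "gaussian_entries m n =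
    (\<Pi>\<^sub>M ij \<in> {..<m} \<times> {..<n}. density lborel (\<lambda>t. ennreal (normal_density 0 (sqrt (1 / real m)) t)))"

definition abs_vec :: "real vec \<Rightarrow> real vec" where
  "abs_vec = map_vec abs"

definition square_vec :: "real vec \<Rightarrow> real vec" where
  "square_vec = map_vec (\<lambda>t. t\<^sup>2)"

definition sqrt_vec :: "real vec \<Rightarrow> real vec" where
  "sqrt_vec = map_vec sqrt"

definition tv_minimizers :: "real mat \<Rightarrow> real vec \<Rightarrow> real vec set" where
  "tv_minimizers A y =
    {x. is_arg_min (\<lambda>x. l1_norm (discrete_grad x))
          (\<lambda>x. x \<in> carrier_vec (dim_col A) \<and> abs_vec (A *\<^sub>v x) = sqrt_vec y) x}"

end

theory Submission
  imports Defs
begin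

text \<open>If \<open>\<bar>A x\<bar> = \<bar>A xbar\<bar>\<close>, then every row of \<open>A\<close> is orthogonal to \<open>x - xbar\<close> or to \<open>x + xbar\<close>, so one
  of these two vectors, which both lie in the total variation descent cone (of \<open>xbar\<close> and of
  \<open>- xbar\<close>), is orthogonal to at least half of the rows. It is therefore enough that, with high
  probability, no nonzero \<open>u\<close> of the cone is orthogonal to half of the rows.

  Summation by parts against a bump that decays like \<open>1 - sqrt (d / l)\<close> at distance \<open>d\<close> from the
  jumps of \<open>xbar\<close> bounds the sum of \<open>sqrt (min d l) * \<bar>u i - u (i - 1)\<bar>\<close> by
  \<open>sqrt (s log n)\<close> times the Euclidean norm of \<open>u\<close>. Cutting \<open>{0..<n}\<close> into dyadic
  intervals around the jumps then writes \<open>u\<close> as a combination of \<open>n\<close> normalised interval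
  indicators, with coefficients of \<open>l\<^sub>1\<close> norm at most \<open>K = O(sqrt (s log n / \<Delta>))\<close> times the norm
  of \<open>u\<close>. By Maurey's empirical method, applied to the Euclidean norm and the empirical energy
  \<open>\<Sum>\<^sub>i \<langle>a\<^sub>i, \<cdot>\<rangle>\<^sup>2\<close> at once, \<open>u\<close> is close in both to one of the \<open>(2n)^L\<close> averages of \<open>L\<close> signed
  indicators, where \<open>L\<close> is of order \<open>K\<^sup>2\<close>. Since \<open>L log n\<close> is small compared with \<open>m\<close>, a union
  bound shows that each such average has small inner product with few rows only, and this
  passes to \<open>u\<close>.\<close>

section \<open>Weighted variation in the descent cone\<close>

text \<open>The jump between positions \<open>i - 1\<close> and \<open>i\<close> carries the index
  \<open>i\<close>, which matches the shifted supports in \<open>{1..n}\<close>; at \<open>0\<close>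
  truncated subtraction makes it zero.\<close>

definition step :: "(nat \<Rightarrow> real) \<Rightarrow> nat \<Rightarrow> real" where
  "step u i = \<bar>u i - u (i - 1)\<bar>"

definition sqnorm :: "nat set \<Rightarrow> (nat \<Rightarrow> real) \<Rightarrow> real" where
  "sqnorm A u = (\<Sum>k\<in>A. (u k)\<^sup>2)"

text \<open>The square-root profile is a compromise: its squared increments decay like
  \<open>1 / (l * d)\<close> and sum to at most \<open>harm l / l\<close>, while the deficit
  \<open>1 - bump l d\<close> still grows like \<open>sqrt (d / l)\<close> and becomes the weight on
  the variation.\<close>

definition bump :: "nat \<Rightarrow> real \<Rightarrow> real" where
  "bump l d = max 0 (1 - sqrt (\<bar>d\<bar> / l))"

lemma step_nonneg [simp]: "0 \<le> step u i"
  by (simp add: step_def)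

lemma sqnorm_nonneg [simp]: "0 \<le> sqnorm A u"
  by (simp add: sqnorm_def sum_nonneg)

lemma bump_nonneg [simp]: "0 \<le> bump l d"
  by (simp add: bump_def)

lemma bump_eq_0: "real l \<le> \<bar>d\<bar> \<Longrightarrow> bump l d = 0" if "l > 0"
  using that by (simp add: bump_def)

lemma bump_eq: "\<bar>d\<bar> \<le> real l \<Longrightarrow> bump l d = 1 - sqrt (\<bar>d\<bar> / l)"
  by (cases "l = 0") (auto simp: bump_def field_simps)

lemma sum_sqrt_le:
  assumes "\<And>i. i \<in> A \<Longrightarrow> 0 \<le> f i"
  shows "(\<Sum>i\<in>A. sqrt (f i)) \<le> sqrt (card A) * sqrt (\<Sum>i\<in>A. f i)"
proof -
  have "(\<Sum>i\<in>A. 1 * sqrt (f i))\<^sup>2 \<le> (\<Sum>i\<in>A. 1\<^sup>2) * (\<Sum>i\<in>A. (sqrt (f i))\<^sup>2)"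
    by (rule Cauchy_Schwarz_ineq_sum)
  also have "(\<Sum>i\<in>A. (sqrt (f i))\<^sup>2) = (\<Sum>i\<in>A. f i)"
    by (intro sum.cong) (auto simp: assms)
  finally have "(\<Sum>i\<in>A. sqrt (f i))\<^sup>2 \<le> card A * (\<Sum>i\<in>A. f i)" by simp
  then show ?thesis
    by (metis real_le_rsqrt real_sqrt_mult)
qed

text \<open>The bump is 1 at \<open>0\<close> and 0 at \<open>l\<close>, so summation by parts
  writes \<open>v 0\<close> as a combination of values minus a combination of increments.
  Cauchy-Schwarz bounds the first combination by the energy.\<close>

lemma half_bump_bound:
  fixes v :: "nat \<Rightarrow> real"
  assumes l: "l \<ge> 1"
  shows "\<bar>v 0\<bar> \<le> sqrt (harm l / l) * sqrt (sqnorm {..<l} v)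
    + (\<Sum>d<l. bump l (real (Suc d)) * \<bar>v (Suc d) - v d\<bar>)"
proof -
  define f where "f d = bump l (real d)" for d :: nat
  have tele: "(\<Sum>d<r. (f d - f (Suc d)) * v d) - (\<Sum>d<r. f (Suc d) * (v (Suc d) - v d)) = f 0 * v 0 - f r * v r" for r
    by (induction r) (auto simp: algebra_simps)
  have f0: "f 0 = 1" "f l = 0" using l by (auto simp: f_def bump_def)
  have v0: "v 0 = (\<Sum>d<l. (f d - f (Suc d)) * v d) - (\<Sum>d<l. f (Suc d) * (v (Suc d) - v d))"
    using tele[of l] f0 by simp
  \<comment> \<open>The roots satisfy \<open>b - a \<le> 1 / b\<close>, because
    \<open>(b - a) * (b + a) = 1\<close>; squaring produces a harmonic term.\<close>
  have df: "(f d - f (Suc d))\<^sup>2 \<le> 1 / l * inverse (real (Suc d))" if "d < l" for d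
  proof -
    define a b where "a = sqrt (real d)" and "b = sqrt (real (Suc d))"
    have ab: "0 \<le> a" "a \<le> b" "0 < b" "b\<^sup>2 - a\<^sup>2 = 1" by (auto simp: a_def b_def)
    have "(b - a) * b \<le> (b - a) * (b + a)" using ab by (intro mult_left_mono) auto
    also have "\<dots> = 1" using ab(4) by (simp add: power2_eq_square algebra_simps)
    finally have "b - a \<le> 1 / b" using ab by (simp add: field_simps)
    then have "(b - a)\<^sup>2 \<le> (1 / b)\<^sup>2" using ab by (intro power_mono) auto
    also have "\<dots> = inverse (real (Suc d))" by (simp add: b_def power_divide inverse_eq_divide)
    finally have 1: "(b - a)\<^sup>2 \<le> inverse (real (Suc d))" .
    have "f d - f (Suc d) = (b - a) / sqrt l"
      using that unfolding f_def by (simp add: bump_eq a_def b_def real_sqrt_divide diff_divide_distrib)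
    then have "(f d - f (Suc d))\<^sup>2 = (b - a)\<^sup>2 / l" by (simp add: power_divide)
    also have "\<dots> \<le> inverse (real (Suc d)) / l" using 1 by (intro divide_right_mono) auto
    finally show ?thesis by simp
  qed
  have "(\<Sum>d<l. (f d - f (Suc d))\<^sup>2) \<le> (\<Sum>d<l. 1 / l * inverse (real (Suc d)))"
    by (intro sum_mono df) auto
  also have "\<dots> = harm l / l"
    by (simp add: harm_def sum_divide_distrib sum.atLeast1_atMost_eq)
  finally have h: "(\<Sum>d<l. (f d - f (Suc d))\<^sup>2) \<le> harm l / l" .
  have "(\<Sum>d<l. (f d - f (Suc d)) * v d)\<^sup>2 \<le> (\<Sum>d<l. (f d - f (Suc d))\<^sup>2) * sqnorm {..<l} v"
    unfolding sqnorm_def by (rule Cauchy_Schwarz_ineq_sum)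
  also have "\<dots> \<le> harm l / l * sqnorm {..<l} v"
    by (intro mult_right_mono h) auto
  finally have 1: "\<bar>\<Sum>d<l. (f d - f (Suc d)) * v d\<bar> \<le> sqrt (harm l / l) * sqrt (sqnorm {..<l} v)"
    by (metis real_sqrt_abs real_sqrt_le_mono real_sqrt_mult)
  have "\<bar>\<Sum>d<l. f (Suc d) * (v (Suc d) - v d)\<bar> \<le> (\<Sum>d<l. \<bar>f (Suc d) * (v (Suc d) - v d)\<bar>)"
    by (rule sum_abs)
  also have "\<dots> = (\<Sum>d<l. f (Suc d) * \<bar>v (Suc d) - v d\<bar>)"
    by (simp add: abs_mult f_def)
  finally show ?thesis using v0 1 unfolding f_def by linarith
qed

text \<open>The bounds keep the windows \<open>{t - l..<t + l}\<close> inside \<open>{..<n}\<close>,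
  and the gap \<open>2 * l\<close> makes them disjoint, so that at most one bump is nonzero at any
  point.\<close>

locale separated_jumps =
  fixes n l :: nat and T :: "nat set"
  assumes l_pos: "l \<ge> 1"
    and T_bounds: "\<And>t. t \<in> T \<Longrightarrow> l \<le> t \<and> t + l \<le> n"
    and T_gap: "\<And>t t'. t \<in> T \<Longrightarrow> t' \<in> T \<Longrightarrow> t < t' \<Longrightarrow> t + 2 * l \<le> t'"
begin

lemma T_subset: "T \<subseteq> {1..<n}"
proof
  fix t assume "t \<in> T"
  with T_bounds[of t] l_pos show "t \<in> {1..<n}" by auto
qed

lemma finite_T [simp]: "finite T"
  using T_subset finite_subset by blast

lemma not_in_T: "t \<in> T \<Longrightarrow> i \<noteq> t \<Longrightarrow> i < t + 2 * l \<Longrightarrow> t < i + 2 * l \<Longrightarrow> i \<notin> T"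
  using T_gap[of t i] T_gap[of i t] by (meson linorder_neqE_nat not_le)

text \<open>The two values beside the jump, \<open>u t\<close> and \<open>u (t - 1)\<close>, are
  each controlled from their own side by \<open>half_bump_bound\<close>, the left one after
  reflection. The window meets no other jump, so all steps that appear lie off
  \<open>T\<close>.\<close>

lemma jump_bound:
  assumes t: "t \<in> T"
  shows "step u t \<le> sqrt (2 * harm l / l) * sqrt (sqnorm {t - l..<t + l} u)
    + (\<Sum>i\<in>{1..<n} - T. bump l (real i - real t) * step u i)"
proof -
  have tl: "l \<le> t" "t + l \<le> n" using T_bounds[OF t] by auto
  define R where "R = (\<Sum>i\<in>{t<..<t + l}. bump l (real i - real t) * step u i)"
  define L where "L = (\<Sum>i\<in>{t - l<..<t}. bump l (real i - real t) * step u i)"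
  obtain l' where l': "l = Suc l'" using l_pos by (cases l) auto
  \<comment> \<open>The last term of a half-sum may involve position \<open>n\<close> on the right
    or a truncated index on the left. The bump vanishes there and the term drops out.\<close>
  have last0: "bump l (real l) = 0" using l_pos by (simp add: bump_eq_0)
  have "\<bar>u (t + 0)\<bar> \<le> sqrt (harm l / l) * sqrt (sqnorm {..<l} (\<lambda>d. u (t + d)))
    + (\<Sum>d<l. bump l (real (Suc d)) * \<bar>u (t + Suc d) - u (t + d)\<bar>)"
    by (rule half_bump_bound[OF l_pos])
  also have "sqnorm {..<l} (\<lambda>d. u (t + d)) = sqnorm {t..<t + l} u"
    unfolding sqnorm_def
    by (rule sum.reindex_bij_witness[of _ "\<lambda>k. k - t" "\<lambda>d. t + d"]) auto
  also have "(\<Sum>d<l. bump l (real (Suc d)) * \<bar>u (t + Suc d) - u (t + d)\<bar>)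
    = (\<Sum>d<l'. bump l (real (Suc d)) * \<bar>u (t + Suc d) - u (t + d)\<bar>)"
    using last0 by (simp add: l')
  also have "\<dots> = R" unfolding R_def
    by (rule sum.reindex_bij_witness[of _ "\<lambda>i. i - t - 1" "\<lambda>d. t + Suc d"]) (auto simp: l' step_def)
  finally have right: "\<bar>u t\<bar> \<le> sqrt (harm l / l) * sqrt (sqnorm {t..<t + l} u) + R" by simp
  have "\<bar>u (t - 1 - 0)\<bar> \<le> sqrt (harm l / l) * sqrt (sqnorm {..<l} (\<lambda>d. u (t - 1 - d)))
    + (\<Sum>d<l. bump l (real (Suc d)) * \<bar>u (t - 1 - Suc d) - u (t - 1 - d)\<bar>)"
    by (rule half_bump_bound[OF l_pos, of "\<lambda>d. u (t - 1 - d)"])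
  also have "sqnorm {..<l} (\<lambda>d. u (t - 1 - d)) = sqnorm {t - l..<t} u"
    unfolding sqnorm_def
    by (rule sum.reindex_bij_witness[of _ "\<lambda>k. t - 1 - k" "\<lambda>d. t - 1 - d"]) (use tl in auto)
  also have "(\<Sum>d<l. bump l (real (Suc d)) * \<bar>u (t - 1 - Suc d) - u (t - 1 - d)\<bar>)
    = (\<Sum>d<l'. bump l (real (Suc d)) * \<bar>u (t - 1 - Suc d) - u (t - 1 - d)\<bar>)"
    using last0 by (simp add: l')
  also have "\<dots> = L" unfolding L_def
    by (rule sum.reindex_bij_witness[of _ "\<lambda>i. t - 1 - i" "\<lambda>d. t - 1 - d"])
      (use tl in \<open>auto simp: l' step_def bump_def of_nat_diff abs_minus_commute\<close>)
  finally have left: "\<bar>u (t - 1)\<bar> \<le> sqrt (harm l / l) * sqrt (sqnorm {t - l..<t} u) + L" by simp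
  have "{t - l..<t + l} = {t - l..<t} \<union> {t..<t + l}" by auto
  then have un: "sqnorm {t - l..<t + l} u = sqnorm {t - l..<t} u + sqnorm {t..<t + l} u"
    unfolding sqnorm_def by (simp add: sum.union_disjoint)
  have "sqrt a + sqrt b \<le> sqrt 2 * sqrt (a + b)" if "0 \<le> a" "0 \<le> b" for a b :: real
  proof -
    have "(sqrt a + sqrt b)\<^sup>2 \<le> 2 * (a + b)"
      using that sum_squares_bound[of "sqrt a" "sqrt b"] by (simp add: power2_sum)
    then show ?thesis by (metis real_le_rsqrt real_sqrt_mult)
  qed
  from this[of "sqnorm {t - l..<t} u" "sqnorm {t..<t + l} u"]
  have "sqrt (harm l / l) * (sqrt (sqnorm {t - l..<t} u) + sqrt (sqnorm {t..<t + l} u))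
    \<le> sqrt (harm l / l) * (sqrt 2 * sqrt (sqnorm {t - l..<t + l} u))"
    by (intro mult_left_mono) (auto simp: un harm_nonneg)
  also have "\<dots> = sqrt (2 * harm l / l) * sqrt (sqnorm {t - l..<t + l} u)"
    by (simp add: real_sqrt_mult real_sqrt_divide)
  finally have q: "sqrt (harm l / l) * sqrt (sqnorm {t - l..<t} u) + sqrt (harm l / l) * sqrt (sqnorm {t..<t + l} u)
    \<le> sqrt (2 * harm l / l) * sqrt (sqnorm {t - l..<t + l} u)" by (simp add: distrib_left)
  have "L + R = (\<Sum>i\<in>{t - l<..<t} \<union> {t<..<t + l}. bump l (real i - real t) * step u i)"
    unfolding L_def R_def by (rule sum.union_disjoint[symmetric]) auto
  also have "\<dots> \<le> (\<Sum>i\<in>{1..<n} - T. bump l (real i - real t) * step u i)"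
  proof (rule sum_mono2)
    show "{t - l<..<t} \<union> {t<..<t + l} \<subseteq> {1..<n} - T"
      using tl not_in_T[OF t] by fastforce
  qed auto
  finally have "L + R \<le> (\<Sum>i\<in>{1..<n} - T. bump l (real i - real t) * step u i)" .
  moreover have "step u t \<le> \<bar>u t\<bar> + \<bar>u (t - 1)\<bar>" by (simp add: step_def)
  ultimately show ?thesis using left right q by linarith
qed

text \<open>This is \<open>sqrt l\<close> times the factor left on a step off \<open>T\<close> once
  the jump bounds are moved across the cone inequality. By \<open>weight_near\<close> and
  \<open>weight_far\<close> it equals \<open>sqrt (min d l)\<close>, with \<open>d\<close> the
  distance to the nearest jump.\<close>

definition weight :: "nat \<Rightarrow> real" where
  "weight i = sqrt l * (1 - (\<Sum>t\<in>T. bump l (real i - real t)))"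

lemma disjoint_neighbourhoods: "disjoint_family_on (\<lambda>t. {t - l..<t + l}) T"
proof -
  have "{t - l..<t + l} \<inter> {t' - l..<t' + l} = {}" if "t \<in> T" "t' \<in> T" "t < t'" for t t'
    using T_gap[OF that] by auto
  then show ?thesis unfolding disjoint_family_on_def
    by (metis Int_commute linorder_neqE_nat)
qed

lemma neighbourhoods_subset: "(\<Union>t\<in>T. {t - l..<t + l}) \<subseteq> {..<n}"
  using T_bounds by fastforce

lemma card_T_bound: "2 * l * card T \<le> n"
proof -
  have "card (\<Union>t\<in>T. {t - l..<t + l}) = (\<Sum>t\<in>T. card {t - l..<t + l})"
    using disjoint_neighbourhoods by (intro card_UN_disjoint) (auto simp: disjoint_family_on_def)
  also have "\<dots> = (\<Sum>t\<in>T. 2 * l)"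
    by (intro sum.cong refl) (auto dest: T_bounds)
  finally have "2 * l * card T = card (\<Union>t\<in>T. {t - l..<t + l})" by simp
  also have "\<dots> \<le> card {..<n}" using neighbourhoods_subset by (intro card_mono) auto
  finally show ?thesis by simp
qed

text \<open>Summing \<open>jump_bound\<close> over \<open>T\<close> and inserting it into the cone
  inequality lets the left side absorb the bump terms. The windows are disjoint, so Cauchy-Schwarz
  over the jumps costs only \<open>sqrt (card T)\<close>.\<close>

lemma weighted_variation_bound:
  assumes cone: "(\<Sum>i\<in>{1..<n} - T. step u i) \<le> (\<Sum>i\<in>T. step u i)"
  shows "(\<Sum>i\<in>{1..<n} - T. weight i * step u i) \<le> sqrt (2 * card T * harm l) * sqrt (sqnorm {..<n} u)"
proof -
  let ?h = "sqrt (2 * harm l / l)"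
  have "(\<Sum>t\<in>T. step u t) \<le> (\<Sum>t\<in>T. ?h * sqrt (sqnorm {t - l..<t + l} u)
    + (\<Sum>i\<in>{1..<n} - T. bump l (real i - real t) * step u i))"
    by (intro sum_mono jump_bound)
  also have "\<dots> = ?h * (\<Sum>t\<in>T. sqrt (sqnorm {t - l..<t + l} u))
    + (\<Sum>i\<in>{1..<n} - T. (\<Sum>t\<in>T. bump l (real i - real t)) * step u i)"
    by (subst sum.distrib, subst sum.swap) (simp add: sum_distrib_left sum_distrib_right)
  finally have 1: "(\<Sum>i\<in>{1..<n} - T. (1 - (\<Sum>t\<in>T. bump l (real i - real t))) * step u i)
    \<le> ?h * (\<Sum>t\<in>T. sqrt (sqnorm {t - l..<t + l} u))"
    using cone by (simp add: left_diff_distrib sum_subtractf)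
  have "(\<Sum>t\<in>T. sqnorm {t - l..<t + l} u) = sqnorm (\<Union>t\<in>T. {t - l..<t + l}) u"
    unfolding sqnorm_def using disjoint_neighbourhoods
    by (intro sum.UNION_disjoint[symmetric]) (auto simp: disjoint_family_on_def)
  also have "\<dots> \<le> sqnorm {..<n} u"
    unfolding sqnorm_def using neighbourhoods_subset by (intro sum_mono2) auto
  finally have 2: "(\<Sum>t\<in>T. sqnorm {t - l..<t + l} u) \<le> sqnorm {..<n} u" .
  have "(\<Sum>t\<in>T. sqrt (sqnorm {t - l..<t + l} u)) \<le> sqrt (card T) * sqrt (\<Sum>t\<in>T. sqnorm {t - l..<t + l} u)"
    by (rule sum_sqrt_le) auto
  also have "\<dots> \<le> sqrt (card T) * sqrt (sqnorm {..<n} u)"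
    using 2 by (intro mult_left_mono) auto
  finally have 3: "(\<Sum>t\<in>T. sqrt (sqnorm {t - l..<t + l} u)) \<le> sqrt (card T) * sqrt (sqnorm {..<n} u)" .
  have "(\<Sum>i\<in>{1..<n} - T. weight i * step u i)
    = sqrt l * (\<Sum>i\<in>{1..<n} - T. (1 - (\<Sum>t\<in>T. bump l (real i - real t))) * step u i)"
    by (simp add: weight_def sum_distrib_left mult.assoc)
  also have "\<dots> \<le> sqrt l * (?h * (sqrt (card T) * sqrt (sqnorm {..<n} u)))"
    using 1 3 by (intro mult_left_mono order_trans[OF 1] mult_left_mono) (auto simp: harm_nonneg)
  also have "\<dots> = sqrt (2 * card T * harm l) * sqrt (sqnorm {..<n} u)"
    using l_pos by (simp add: real_sqrt_mult real_sqrt_divide)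
  finally show ?thesis .
qed

text \<open>Any other jump is at least \<open>2 * l\<close> away from \<open>t\<close>, hence at
  least \<open>l\<close> away from \<open>i\<close>, where its bump vanishes.\<close>

lemma weight_near:
  assumes t: "t \<in> T" and d: "\<bar>real i - real t\<bar> \<le> l"
  shows "weight i = sqrt \<bar>real i - real t\<bar>"
proof -
  have "(\<Sum>t'\<in>T. bump l (real i - real t')) = (\<Sum>t'\<in>{t}. bump l (real i - real t'))"
  proof (rule sum.mono_neutral_right)
    show "\<forall>t'\<in>T - {t}. bump l (real i - real t') = 0"
    proof
      fix t' assume t': "t' \<in> T - {t}"
      then have "real t' + 2 * l \<le> real t \<or> real t + 2 * l \<le> real t'"
        using T_gap[of t t'] T_gap[of t' t] t
        by (metis (no_types, opaque_lifting) DiffE linorder_neqE_nat of_nat_add of_nat_le_iff of_nat_mult of_nat_numeral singletonI)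
      then have "real l \<le> \<bar>real i - real t'\<bar>" using d by linarith
      then show "bump l (real i - real t') = 0" using l_pos by (simp add: bump_eq_0)
    qed
  qed (use t in auto)
  then show ?thesis using d l_pos by (simp add: weight_def bump_eq real_sqrt_divide)
qed

lemma weight_far:
  assumes "\<And>t. t \<in> T \<Longrightarrow> real l \<le> \<bar>real i - real t\<bar>"
  shows "weight i = sqrt l"
  using assms l_pos by (simp add: weight_def bump_eq_0)

end

section \<open>Decomposition into interval indicators\<close>

text \<open>With \<open>Q\<close> read as the left ends of a partition into blocks, this is the rest
  of a block from \<open>i\<close> on, and the whole block if \<open>i\<close> belongs to
  \<open>Q\<close>.\<close>

definition run :: "nat \<Rightarrow> nat set \<Rightarrow> nat \<Rightarrow> nat set" where
  "run n Q i = {k. i \<le> k \<and> k < n \<and> {i<..k} \<inter> Q = {}}"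

definition run_coeff :: "nat set \<Rightarrow> (nat \<Rightarrow> real) \<Rightarrow> nat \<Rightarrow> real" where
  "run_coeff Q u i = (if i \<in> Q then u i else u i - u (i - 1))"

lemma finite_run [simp]: "finite (run n Q i)"
  unfolding run_def by (rule finite_subset[of _ "{..<n}"]) auto

lemma run_self: "i < n \<Longrightarrow> i \<in> run n Q i"
  by (auto simp: run_def)

text \<open>Within a block the coefficients telescope: the left end contributes the value of
  \<open>u\<close> there and each later position its increment. The indicator discards every
  \<open>i\<close> that a point of \<open>Q\<close> separates from \<open>k\<close>.\<close>

lemma run_decomposition:
  assumes Q: "0 \<in> Q" and k: "k < n"
  shows "u k = (\<Sum>i<n. run_coeff Q u i * indicator (run n Q i) k)"
proof -
  have "u k = (\<Sum>i\<le>k. run_coeff Q u i * (if {i<..k} \<inter> Q = {} then 1 else 0))"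
  proof (induction k)
    case 0
    then show ?case using Q by (simp add: run_coeff_def)
  next
    case (Suc k)
    have Ioc: "{i<..Suc k} = insert (Suc k) {i<..k}" if "i \<le> k" for i using that by auto
    show ?case
    proof (cases "Suc k \<in> Q")
      case True
      have "(\<Sum>i\<le>k. run_coeff Q u i * (if {i<..Suc k} \<inter> Q = {} then 1 else 0)) = 0"
        using True by (intro sum.neutral) (auto simp: Ioc)
      then show ?thesis using True by (simp add: run_coeff_def)
    next
      case False
      have "(\<Sum>i\<le>k. run_coeff Q u i * (if {i<..Suc k} \<inter> Q = {} then 1 else 0))
        = (\<Sum>i\<le>k. run_coeff Q u i * (if {i<..k} \<inter> Q = {} then 1 else 0))"
        using False by (intro sum.cong refl) (simp add: Ioc)
      then show ?thesis using Suc.IH False by (simp add: run_coeff_def)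
    qed
  qed
  also have "\<dots> = (\<Sum>i\<le>k. run_coeff Q u i * indicator (run n Q i) k)"
    using k by (intro sum.cong refl) (auto simp: run_def indicator_def)
  also have "\<dots> = (\<Sum>i<n. run_coeff Q u i * indicator (run n Q i) k)"
    using k by (intro sum.mono_neutral_left) (auto simp: run_def indicator_def)
  finally show ?thesis .
qed

lemma exists_run_start:
  assumes "0 \<in> Q" "i < n"
  shows "\<exists>q\<in>Q. i \<in> run n Q q \<and> run n Q i \<subseteq> run n Q q"
proof -
  define q where "q = Max (Q \<inter> {..i})"
  have "q \<in> Q \<inter> {..i}" unfolding q_def using assms by (intro Max_in) auto
  moreover have "x \<le> q" if "x \<in> Q" "x \<le> i" for x unfolding q_def using that by (intro Max_ge) auto
  ultimately have "q \<in> Q" "i \<in> run n Q q" "run n Q i \<subseteq> run n Q q" using assms unfolding run_def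
    by (fastforce simp: disjoint_iff)+
  then show ?thesis by blast
qed

lemma disjoint_runs: "disjoint_family_on (run n Q) Q"
proof -
  have "run n Q q \<inter> run n Q q' = {}" if "q \<in> Q" "q' \<in> Q" "q < q'" for q q'
    using that unfolding run_def by (auto simp: disjoint_iff)
  then show ?thesis unfolding disjoint_family_on_def
    by (metis Int_commute linorder_neqE_nat)
qed

lemma variation_on_run:
  assumes "k \<in> run n Q q"
  shows "\<bar>u q\<bar> \<le> \<bar>u k\<bar> + (\<Sum>i\<in>run n Q q - {q}. step u i)"
proof -
  have "\<bar>u q\<bar> \<le> \<bar>u k\<bar> + (\<Sum>i\<in>{q<..k}. step u i)" if "q \<le> k" for k
    using that
  proof (induction k rule: dec_induct)
    case (step k)
    have "{q<..Suc k} = insert (Suc k) {q<..k}" using step(1) by auto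
    then have "(\<Sum>i\<in>{q<..Suc k}. step u i) = step u (Suc k) + (\<Sum>i\<in>{q<..k}. step u i)" by simp
    moreover have "\<bar>u k\<bar> \<le> \<bar>u (Suc k)\<bar> + step u (Suc k)" by (simp add: step_def)
    ultimately show ?case using step by linarith
  qed simp
  moreover have "(\<Sum>i\<in>{q<..k}. step u i) \<le> (\<Sum>i\<in>run n Q q - {q}. step u i)"
    using assms by (intro sum_mono2) (auto simp: run_def disjoint_iff)
  ultimately show ?thesis using assms by (fastforce simp: run_def)
qed

text \<open>Every value on the run has modulus at least \<open>\<bar>u q\<bar>\<close> minus the
  variation there, so the energy of the run is at least its length times the square of that
  difference. Truncating the difference at zero is what allows squaring.\<close>

lemma run_start_bound:
  assumes "q < n"
  shows "\<bar>u q\<bar> * sqrt (card (run n Q q))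
    \<le> sqrt (sqnorm (run n Q q) u) + sqrt (card (run n Q q)) * (\<Sum>i\<in>run n Q q - {q}. step u i)"
proof -
  let ?R = "run n Q q" and ?V = "\<Sum>i\<in>run n Q q - {q}. step u i"
  define a where "a = max 0 (\<bar>u q\<bar> - ?V)"
  have "a\<^sup>2 \<le> (u k)\<^sup>2" if "k \<in> ?R" for k
  proof -
    have "a \<le> \<bar>u k\<bar>" using variation_on_run[OF that, of u] by (auto simp: a_def)
    then show ?thesis by (simp add: a_def abs_le_square_iff[symmetric])
  qed
  then have "card ?R * a\<^sup>2 \<le> sqnorm ?R u"
    unfolding sqnorm_def using sum_mono[of ?R "\<lambda>_. a\<^sup>2"] by simp
  then have "sqrt (card ?R * a\<^sup>2) \<le> sqrt (sqnorm ?R u)" by (rule real_sqrt_le_mono)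
  then have "sqrt (card ?R) * a \<le> sqrt (sqnorm ?R u)" by (simp add: real_sqrt_mult a_def)
  moreover have "sqrt (card ?R) * (\<bar>u q\<bar> - ?V) \<le> sqrt (card ?R) * a"
    by (intro mult_left_mono) (auto simp: a_def)
  ultimately show ?thesis by (simp add: algebra_simps)
qed

text \<open>The variation enters twice: through the coefficients off \<open>Q\<close>, which are
  increments, and through \<open>run_start_bound\<close> at the points of \<open>Q\<close>. The
  blocks are disjoint, so Cauchy-Schwarz over \<open>Q\<close> gives the factor
  \<open>sqrt (card Q)\<close>.\<close>

lemma run_l1_bound:
  assumes Q: "0 \<in> Q" "Q \<subseteq> {..<n}"
    and w: "\<And>q i. q \<in> Q \<Longrightarrow> i \<in> run n Q q - {q} \<Longrightarrow> sqrt (card (run n Q q)) \<le> w i"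
  shows "(\<Sum>i<n. \<bar>run_coeff Q u i\<bar> * sqrt (card (run n Q i)))
    \<le> sqrt (card Q) * sqrt (sqnorm {..<n} u) + 2 * (\<Sum>i\<in>{..<n} - Q. w i * step u i)"
proof -
  let ?c = "\<lambda>i. \<bar>run_coeff Q u i\<bar> * sqrt (card (run n Q i))"
  have finQ: "finite Q" using Q(2) finite_subset by blast
  \<comment> \<open>The run from \<open>i\<close> lies in the run of the left end of its block, so
    the bound assumed for blocks passes to it.\<close>
  have w0: "sqrt (card (run n Q i)) \<le> w i" if i: "i < n" "i \<notin> Q" for i
  proof -
    obtain q where q: "q \<in> Q" "i \<in> run n Q q" "run n Q i \<subseteq> run n Q q"
      using exists_run_start[OF Q(1) i(1)] by blast
    then have "card (run n Q i) \<le> card (run n Q q)" by (intro card_mono) auto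
    then have "sqrt (card (run n Q i)) \<le> sqrt (card (run n Q q))" by simp
    also have "\<dots> \<le> w i" using q i by (intro w) auto
    finally show ?thesis .
  qed
  have nonQ: "(\<Sum>i\<in>{..<n} - Q. ?c i) \<le> (\<Sum>i\<in>{..<n} - Q. w i * step u i)"
  proof (rule sum_mono)
    fix i assume i: "i \<in> {..<n} - Q"
    then have "?c i = step u i * sqrt (card (run n Q i))" by (simp add: run_coeff_def step_def)
    also have "\<dots> \<le> step u i * w i" using i by (intro mult_left_mono w0) auto
    finally show "?c i \<le> w i * step u i" by (simp add: mult.commute)
  qed
  have un: "(\<Union>q\<in>Q. run n Q q) \<subseteq> {..<n}" "(\<Union>q\<in>Q. run n Q q - {q}) \<subseteq> {..<n} - Q"
    by (auto simp: run_def disjoint_iff)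
  have "(\<Sum>q\<in>Q. ?c q) \<le> (\<Sum>q\<in>Q. sqrt (sqnorm (run n Q q) u) + (\<Sum>i\<in>run n Q q - {q}. w i * step u i))"
  proof (rule sum_mono)
    fix q assume q: "q \<in> Q"
    then have "?c q = \<bar>u q\<bar> * sqrt (card (run n Q q))" by (simp add: run_coeff_def)
    also have "\<dots> \<le> sqrt (sqnorm (run n Q q) u) + sqrt (card (run n Q q)) * (\<Sum>i\<in>run n Q q - {q}. step u i)"
      using q Q by (intro run_start_bound) auto
    also have "sqrt (card (run n Q q)) * (\<Sum>i\<in>run n Q q - {q}. step u i) \<le> (\<Sum>i\<in>run n Q q - {q}. w i * step u i)"
      unfolding sum_distrib_left using q by (intro sum_mono mult_right_mono w) auto
    finally show "?c q \<le> sqrt (sqnorm (run n Q q) u) + (\<Sum>i\<in>run n Q q - {q}. w i * step u i)" by simp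
  qed
  also have "\<dots> = (\<Sum>q\<in>Q. sqrt (sqnorm (run n Q q) u)) + (\<Sum>q\<in>Q. \<Sum>i\<in>run n Q q - {q}. w i * step u i)"
    by (rule sum.distrib)
  also have "(\<Sum>q\<in>Q. \<Sum>i\<in>run n Q q - {q}. w i * step u i) = (\<Sum>i\<in>(\<Union>q\<in>Q. run n Q q - {q}). w i * step u i)"
    using disjoint_runs[of n Q] finQ
    by (intro sum.UNION_disjoint[symmetric]) (auto simp: disjoint_family_on_def)
  also have "\<dots> \<le> (\<Sum>i\<in>{..<n} - Q. w i * step u i)"
    using un(2) w0 by (intro sum_mono2) (auto intro!: mult_nonneg_nonneg order_trans[OF real_sqrt_ge_zero w0])
  also have "(\<Sum>q\<in>Q. sqrt (sqnorm (run n Q q) u)) \<le> sqrt (card Q) * sqrt (\<Sum>q\<in>Q. sqnorm (run n Q q) u)"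
    by (rule sum_sqrt_le) auto
  also have "(\<Sum>q\<in>Q. sqnorm (run n Q q) u) = sqnorm (\<Union>q\<in>Q. run n Q q) u"
    unfolding sqnorm_def using disjoint_runs[of n Q] finQ
    by (intro sum.UNION_disjoint[symmetric]) (auto simp: disjoint_family_on_def)
  also have "sqrt (card Q) * sqrt \<dots> \<le> sqrt (card Q) * sqrt (sqnorm {..<n} u)"
    using un(1) unfolding sqnorm_def by (intro mult_left_mono real_sqrt_le_mono sum_mono2) auto
  finally have onQ: "(\<Sum>q\<in>Q. ?c q) \<le> sqrt (card Q) * sqrt (sqnorm {..<n} u) + (\<Sum>i\<in>{..<n} - Q. w i * step u i)"
    by simp
  have "(\<Sum>i<n. ?c i) = (\<Sum>i\<in>{..<n} - Q. ?c i) + (\<Sum>q\<in>Q. ?c q)"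
    by (rule sum.subset_diff[OF Q(2)]) simp
  then show ?thesis using nonQ onQ by linarith
qed

section \<open>The grid of multiples and dyadic distances\<close>

context separated_jumps
begin

text \<open>The dyadic distances to the jumps make the run around a point no longer than its distance to the
  nearest jump, and the multiples of \<open>l\<close> make it no longer than \<open>l\<close>. Here \<open>t - 2 ^ a\<close> is truncated
  at \<open>0\<close>, which belongs to the grid anyway.\<close>

definition grid :: "nat set" where
  "grid = ({0} \<union> T \<union> (\<lambda>(t, a). t + 2 ^ a) ` (T \<times> {a. 2 ^ a < n})
    \<union> (\<lambda>(t, a). t - 2 ^ a) ` (T \<times> {a. 2 ^ a < n}) \<union> (\<lambda>j. l * j) ` {..n div l}) \<inter> {..<n}"

lemma finite_exponents [simp]: "finite {a. (2::nat) ^ a < n}"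
  by (rule finite_subset[of _ "{..<n}"]) (auto intro: less_trans[OF less_exp])

lemma card_grid: "card grid \<le> 1 + card T + 2 * (card T * card {a. (2::nat) ^ a < n}) + (n div l + 1)"
proof -
  let ?A = "{a. (2::nat) ^ a < n}"
  let ?X = "(\<lambda>(t, a). t + 2 ^ a) ` (T \<times> ?A)" and ?Y = "(\<lambda>(t, a). t - 2 ^ a) ` (T \<times> ?A)"
    and ?Z = "(\<lambda>j. l * j) ` {..n div l}"
  have "card grid \<le> card ({0} \<union> T \<union> ?X \<union> ?Y \<union> ?Z)"
    unfolding grid_def by (intro card_mono) auto
  also have "\<dots> \<le> card {0::nat} + card T + card ?X + card ?Y + card ?Z"
    by (intro order_trans[OF card_Un_le] add_mono order_refl)
  also have "\<dots> \<le> 1 + card T + card T * card ?A + card T * card ?A + (n div l + 1)"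
    by (intro add_mono) (auto intro: order_trans[OF card_image_le] simp: card_cartesian_product)
  finally show ?thesis by simp
qed

text \<open>With \<open>r\<close> the last point of the block, no grid point lies after
  \<open>q\<close> and up to \<open>r\<close>. The multiples of \<open>l\<close> then bound the
  length by \<open>l\<close>, and near a jump the dyadic points bound it by the distance from
  \<open>i\<close> to that jump; these are the two regimes of \<open>weight\<close>.\<close>

lemma run_grid_card:
  assumes q: "q \<in> grid" and i: "i \<in> run n grid q - {q}"
  shows "sqrt (card (run n grid q)) \<le> weight i"
proof -
  let ?R = "run n grid q"
  define r where "r = Max ?R"
  have r: "r \<in> ?R" unfolding r_def using i by (intro Max_in) auto
  have "k \<le> r" if "k \<in> ?R" for k unfolding r_def using that by (intro Max_ge) auto
  then have "?R \<subseteq> {q..r}" by (auto simp: run_def)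
  then have cR: "card ?R \<le> r + 1 - q" using card_mono[of "{q..r}" ?R] by simp
  have qi: "q < i" "i \<le> r" "r < n" and free: "\<And>x. q < x \<Longrightarrow> x \<le> r \<Longrightarrow> x \<notin> grid"
    using i r \<open>\<And>k. k \<in> ?R \<Longrightarrow> k \<le> r\<close> by (auto simp: run_def)
  have i_grid: "i \<notin> grid" using free qi by auto
  have cl: "r + 1 - q \<le> l"
  proof (rule ccontr)
    assume neg: "\<not> r + 1 - q \<le> l"
    \<comment> \<open>The first multiple of \<open>l\<close> after \<open>q\<close>, at most
      \<open>l\<close> further on; a block of more than \<open>l\<close> points would reach
      it.\<close>
    define x where "x = l * (q div l + 1)"
    have "q = l * (q div l) + q mod l" "q mod l < l" using l_pos by auto
    then have "q < x" "x \<le> q + l" unfolding x_def distrib_left by linarith+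
    then have x: "q < x" "x \<le> r" using neg by auto
    have "q div l + 1 \<le> n div l"
      using x(2) qi l_pos by (simp add: x_def less_eq_div_iff_mult_less_eq mult.commute)
    then have "x \<in> (\<lambda>j. l * j) ` {..n div l}" unfolding x_def by (intro imageI) simp
    then have "x \<in> grid" using x qi unfolding grid_def by auto
    then show False using free x by auto
  qed
  have i0: "i < n" using qi by simp
  show ?thesis
  proof (cases "\<exists>t\<in>T. \<bar>real i - real t\<bar> \<le> real l")
    case False
    then have "weight i = sqrt l" by (intro weight_far) force
    moreover have "card ?R \<le> l" using cR cl by linarith
    ultimately show ?thesis by simp
  next
    case True
    then obtain t where t: "t \<in> T" "\<bar>real i - real t\<bar> \<le> real l" by auto
    have wi: "weight i = sqrt \<bar>real i - real t\<bar>" by (rule weight_near[OF t])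
    have tn: "t < n" "t \<in> grid" using t(1) T_subset by (auto simp: grid_def)
    have gr: "t + 2 ^ a \<in> grid" if "t + 2 ^ a < n" for a
      using that t(1) unfolding grid_def by (auto intro!: rev_image_eqI[of "(t, a)"])
    have gl: "t - 2 ^ a \<in> grid" if "2 ^ a < n" for a
      using that t(1) tn unfolding grid_def by (auto intro!: rev_image_eqI[of "(t, a)"])
    have dy: "\<exists>a. 2 ^ a \<le> d \<and> d < 2 * 2 ^ a" if "d \<ge> 1" for d :: nat
      using ex_power_ivl1[of 2 d] that by auto
    have it: "i \<noteq> t" using tn i_grid by auto
    consider (right) "t < i" | (left) "i < t" using it by linarith
    then have "r + 1 - q \<le> (if t < i then i - t else t - i)"
    proof cases
      case right
      \<comment> \<open>The block is trapped between \<open>t + 2 ^ a\<close> and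
        \<open>t + 2 ^ (a + 1)\<close>, so it has at most \<open>2 ^ a \<le> i - t\<close>
        points.\<close>
      obtain a where a: "2 ^ a \<le> i - t" "i - t < 2 * 2 ^ a" using dy[of "i - t"] right by (metis less_eq_Suc_le One_nat_def zero_less_diff)
      have "t + 2 ^ a \<in> grid" using a qi right by (intro gr) linarith
      then have "t + 2 ^ a \<le> q" using free[of "t + 2 ^ a"] a right qi by linarith
      moreover have "r < t + 2 * 2 ^ a"
      proof (rule ccontr)
        assume "\<not> r < t + 2 * 2 ^ a"
        then have le: "t + 2 ^ Suc a \<le> r" by simp
        have "t + 2 ^ Suc a \<in> grid" using qi le by (intro gr) linarith
        moreover have "q < t + 2 ^ Suc a" using a qi right unfolding power_Suc by linarith
        ultimately show False using free[of "t + 2 ^ Suc a"] le by blast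
      qed
      ultimately show ?thesis using a right by simp
    next
      case left
      \<comment> \<open>The mirror image, between \<open>t - 2 ^ (a + 1)\<close> and
        \<open>t - 2 ^ a\<close>. If \<open>2 ^ (a + 1)\<close> reaches \<open>n\<close>, the lower
        end is automatic because \<open>t < n\<close>.\<close>
      obtain a where a: "2 ^ a \<le> t - i" "t - i < 2 * 2 ^ a" using dy[of "t - i"] left by (metis less_eq_Suc_le One_nat_def zero_less_diff)
      have "t - 2 ^ a \<in> grid" using a tn by (intro gl) linarith
      moreover have "i \<le> t - 2 ^ a" "2 ^ a \<le> t" using a left by auto
      ultimately have "r < t - 2 ^ a" using free[of "t - 2 ^ a"] i_grid qi
        by (metis le_less_trans not_le order_less_le)
      moreover have "t \<le> q + 2 * 2 ^ a"
      proof (cases "2 ^ Suc a < n")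
        case True
        then have "t - 2 ^ Suc a \<in> grid" by (rule gl)
        moreover have "t - 2 ^ Suc a \<le> r" using a left qi unfolding power_Suc by linarith
        ultimately have "\<not> q < t - 2 ^ Suc a" using free by blast
        then show ?thesis unfolding power_Suc by linarith
      qed (use tn in simp)
      ultimately show ?thesis using a left by simp
    qed
    then have "real (card ?R) \<le> \<bar>real i - real t\<bar>" using cR it by (auto split: if_splits)
    then show ?thesis unfolding wi by simp
  qed
qed

lemma grid_l1_bound:
  assumes n: "n > 0" and cone: "(\<Sum>i\<in>{1..<n} - T. step u i) \<le> (\<Sum>i\<in>T. step u i)"
  shows "(\<Sum>i<n. \<bar>run_coeff grid u i\<bar> * sqrt (card (run n grid i)))
    \<le> (sqrt (card grid) + 2 * sqrt (2 * card T * harm l)) * sqrt (sqnorm {..<n} u)"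
proof -
  have g: "0 \<in> grid" "grid \<subseteq> {..<n}" "T \<subseteq> grid"
    using n T_subset by (auto simp: grid_def)
  have w0: "0 \<le> weight i" if "i < n" for i
  proof (cases "\<exists>t\<in>T. \<bar>real i - real t\<bar> \<le> real l")
    case False
    then have "weight i = sqrt l" by (intro weight_far) force
    then show ?thesis by simp
  next
    case True
    then show ?thesis using weight_near by fastforce
  qed
  have "(\<Sum>i\<in>{..<n} - grid. weight i * step u i) \<le> (\<Sum>i\<in>{1..<n} - T. weight i * step u i)"
    using g w0 by (intro sum_mono2) (auto simp: Suc_le_eq intro: Suc_leI gr0I)
  also have "\<dots> \<le> sqrt (2 * card T * harm l) * sqrt (sqnorm {..<n} u)"
    by (rule weighted_variation_bound[OF cone])
  finally show ?thesis
    using run_l1_bound[where u = u and w = weight, OF g(1,2) run_grid_card] by (simp add: algebra_simps)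
qed

end

section \<open>Maurey's empirical method\<close>

text \<open>If \<open>p\<close> is drawn with probability \<open>lam p\<close>, then
  \<open>v p - u\<close> has mean zero and second moment at most \<open>B\<close>. The average of
  the left side is thus at most the right side, and some \<open>p\<close> does no worse than the
  average.\<close>

lemma maurey_step:
  fixes lam :: "'p \<Rightarrow> real" and v :: "'p \<Rightarrow> 'x \<Rightarrow> real"
  assumes fin: "finite P" "finite I"
    and lam: "\<And>p. p \<in> P \<Longrightarrow> 0 \<le> lam p" "(\<Sum>p\<in>P. lam p) = 1"
    and B: "\<And>p. p \<in> P \<Longrightarrow> (\<Sum>x\<in>I. (v p x)\<^sup>2) \<le> B"
    and u: "\<And>x. x \<in> I \<Longrightarrow> u x = (\<Sum>p\<in>P. lam p * v p x)"
  shows "\<exists>p\<in>P. (\<Sum>x\<in>I. (r x + (v p x - u x))\<^sup>2) \<le> (\<Sum>x\<in>I. (r x)\<^sup>2) + B"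
proof (rule ccontr)
  let ?f = "\<lambda>p. \<Sum>x\<in>I. (r x + (v p x - u x))\<^sup>2"
  assume "\<not> ?thesis"
  then have gt: "(\<Sum>x\<in>I. (r x)\<^sup>2) + B < ?f p" if "p \<in> P" for p using that by force
  have "(\<Sum>p\<in>P. lam p * (r x + (v p x - u x))\<^sup>2) \<le> (r x)\<^sup>2 + (\<Sum>p\<in>P. lam p * (v p x)\<^sup>2)" if x: "x \<in> I" for x
  proof -
    have "(\<Sum>p\<in>P. lam p * (r x + (v p x - u x))\<^sup>2)
      = (\<Sum>p\<in>P. lam p * (r x - u x)\<^sup>2 + 2 * (r x - u x) * (lam p * v p x) + lam p * (v p x)\<^sup>2)"
      by (intro sum.cong refl) (simp add: power2_eq_square algebra_simps)
    also have "\<dots> = (r x - u x)\<^sup>2 + 2 * (r x - u x) * u x + (\<Sum>p\<in>P. lam p * (v p x)\<^sup>2)"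
      by (simp add: sum.distrib sum_distrib_left[symmetric] sum_distrib_right[symmetric] lam u[OF x])
    \<comment> \<open>The first two terms add up to
      \<open>(r x)\<^sup>2 - (u x)\<^sup>2\<close>.\<close>
    also have "\<dots> \<le> (r x)\<^sup>2 + (\<Sum>p\<in>P. lam p * (v p x)\<^sup>2)"
      by (simp add: power2_eq_square algebra_simps)
    finally show ?thesis .
  qed
  then have "(\<Sum>x\<in>I. \<Sum>p\<in>P. lam p * (r x + (v p x - u x))\<^sup>2) \<le> (\<Sum>x\<in>I. (r x)\<^sup>2 + (\<Sum>p\<in>P. lam p * (v p x)\<^sup>2))"
    by (rule sum_mono)
  also have "\<dots> = (\<Sum>x\<in>I. (r x)\<^sup>2) + (\<Sum>p\<in>P. lam p * (\<Sum>x\<in>I. (v p x)\<^sup>2))"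
    by (subst sum.distrib, subst sum.swap) (simp add: sum_distrib_left)
  also have "(\<Sum>p\<in>P. lam p * (\<Sum>x\<in>I. (v p x)\<^sup>2)) \<le> (\<Sum>p\<in>P. lam p * B)"
    by (intro sum_mono mult_left_mono B lam)
  also have "\<dots> = B" by (simp add: sum_distrib_right[symmetric] lam)
  also have "(\<Sum>x\<in>I. \<Sum>p\<in>P. lam p * (r x + (v p x - u x))\<^sup>2) = (\<Sum>p\<in>P. lam p * ?f p)"
    by (subst sum.swap) (simp add: sum_distrib_left)
  finally have le: "(\<Sum>p\<in>P. lam p * ?f p) \<le> (\<Sum>x\<in>I. (r x)\<^sup>2) + B" by simp
  obtain p0 where p0: "p0 \<in> P" "lam p0 > 0"
    using lam by (metis less_eq_real_def sum.neutral zero_neq_one)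
  have "((\<Sum>x\<in>I. (r x)\<^sup>2) + B) = (\<Sum>p\<in>P. lam p * ((\<Sum>x\<in>I. (r x)\<^sup>2) + B))"
    by (simp add: sum_distrib_right[symmetric] lam)
  also have "\<dots> < (\<Sum>p\<in>P. lam p * ?f p)"
  proof (rule sum_strict_mono_ex1[OF fin(1)])
    show "\<forall>p\<in>P. lam p * ((\<Sum>x\<in>I. (r x)\<^sup>2) + B) \<le> lam p * ?f p"
      using gt lam by (intro ballI mult_left_mono) (auto intro: less_imp_le)
    show "\<exists>p\<in>P. lam p * ((\<Sum>x\<in>I. (r x)\<^sup>2) + B) < lam p * ?f p"
      using gt[OF p0(1)] p0 by (intro bexI[of _ p0] mult_strict_left_mono)
  qed
  finally show False using le by linarith
qed

text \<open>Maurey's empirical method, derandomised: the next atom is chosen so that the squared error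
  grows by no more than its average, and in the average the cross term vanishes.\<close>

lemma maurey:
  fixes lam :: "'p \<Rightarrow> real" and v :: "'p \<Rightarrow> 'x \<Rightarrow> real"
  assumes "finite P" "finite I"
    and "\<And>p. p \<in> P \<Longrightarrow> 0 \<le> lam p" "(\<Sum>p\<in>P. lam p) = 1"
    and "\<And>p. p \<in> P \<Longrightarrow> (\<Sum>x\<in>I. (v p x)\<^sup>2) \<le> B"
    and "\<And>x. x \<in> I \<Longrightarrow> u x = (\<Sum>p\<in>P. lam p * v p x)"
  shows "\<exists>ps. length ps = L \<and> set ps \<subseteq> P
    \<and> (\<Sum>x\<in>I. ((\<Sum>p\<leftarrow>ps. v p x) - real L * u x)\<^sup>2) \<le> real L * B"
proof (induction L)
  case (Suc L)
  then obtain ps where ps: "length ps = L" "set ps \<subseteq> P"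
    "(\<Sum>x\<in>I. ((\<Sum>p\<leftarrow>ps. v p x) - real L * u x)\<^sup>2) \<le> real L * B" by blast
  obtain p where p: "p \<in> P" "(\<Sum>x\<in>I. ((\<Sum>p\<leftarrow>ps. v p x) - real L * u x + (v p x - u x))\<^sup>2)
      \<le> (\<Sum>x\<in>I. ((\<Sum>p\<leftarrow>ps. v p x) - real L * u x)\<^sup>2) + B"
    using maurey_step[OF assms, of "\<lambda>x. (\<Sum>p\<leftarrow>ps. v p x) - real L * u x"] by blast
  then show ?case using ps
    by (intro exI[of _ "p # ps"]) (auto simp: algebra_simps)
qed simp

section \<open>Gaussian rows\<close>

definition row_dot :: "(nat \<times> nat \<Rightarrow> real) \<Rightarrow> nat \<Rightarrow> nat \<Rightarrow> (nat \<Rightarrow> real) \<Rightarrow> real" where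
  "row_dot w n i z = (\<Sum>k<n. w (i, k) * z k)"

abbreviation gauss :: "real \<Rightarrow> real measure" where
  "gauss \<sigma> \<equiv> density lborel (\<lambda>t. ennreal (normal_density 0 \<sigma> t))"

lemma prob_space_gaussian_entries: "m > 0 \<Longrightarrow> prob_space (gaussian_entries m n)"
  unfolding gaussian_entries_def by (intro prob_space_PiM prob_space_normal_density) simp

lemma sets_gaussian_entries [measurable_cong]:
  "sets (gaussian_entries m n) = sets (\<Pi>\<^sub>M ij \<in> {..<m} \<times> {..<n}. borel)"
  unfolding gaussian_entries_def by (intro sets_PiM_cong) auto

lemma entry_measurable:
  "i < m \<Longrightarrow> k < n \<Longrightarrow> (\<lambda>w. w (i, k)) \<in> borel_measurable (gaussian_entries m n)"
  by (subst measurable_cong_sets[OF sets_gaussian_entries refl])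
     (rule measurable_component_singleton, auto)

lemma row_dot_measurable:
  "i < m \<Longrightarrow> (\<lambda>w. row_dot w n i z) \<in> borel_measurable (gaussian_entries m n)"
  unfolding row_dot_def by (intro borel_measurable_sum borel_measurable_times entry_measurable) auto

lemma distr_entry:
  assumes "ij \<in> {..<m} \<times> {..<n}"
  shows "distr (gaussian_entries m n) borel (\<lambda>w. w ij) = gauss (sqrt (1 / m))"
proof -
  have "distr (gaussian_entries m n) borel (\<lambda>w. w ij)
    = distr (gaussian_entries m n) (gauss (sqrt (1 / m))) (\<lambda>w. w ij)"
    by (rule distr_cong) auto
  also have "\<dots> = gauss (sqrt (1 / m))"
    unfolding gaussian_entries_def
    by (rule distr_PiM_component[OF _ assms]) (use assms in \<open>auto intro!: prob_space_normal_density\<close>)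
  finally show ?thesis .
qed

text \<open>Independence is checked as equality of the joint law with the product of the marginals.
  Outcomes of the product space are extensional, so the joint map is the identity and both sides are
  the measure itself.\<close>

lemma indep_entries:
  assumes "m > 0" "n > 0"
  shows "prob_space.indep_vars (gaussian_entries m n) (\<lambda>_. borel) (\<lambda>ij w. w ij) ({..<m} \<times> {..<n})"
proof -
  let ?M = "gaussian_entries m n" and ?I = "{..<m} \<times> {..<n}"
  interpret prob_space ?M using assms by (intro prob_space_gaussian_entries) simp
  have "distr ?M (PiM ?I (\<lambda>_. borel)) (\<lambda>w. \<lambda>ij\<in>?I. w ij) = distr ?M ?M (\<lambda>w. w)"
  proof (rule distr_cong)
    fix w assume "w \<in> space ?M"
    then show "(\<lambda>ij\<in>?I. w ij) = w" by (auto simp: gaussian_entries_def space_PiM)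
  qed (auto simp: sets_gaussian_entries)
  also have "\<dots> = ?M" by (rule distr_id)
  also have "?M = PiM ?I (\<lambda>ij. distr ?M borel (\<lambda>w. w ij))"
  proof -
    have "PiM ?I (\<lambda>ij. distr ?M borel (\<lambda>w. w ij)) = PiM ?I (\<lambda>ij. gauss (sqrt (1 / m)))"
      by (intro PiM_cong distr_entry refl)
    then show ?thesis unfolding gaussian_entries_def by simp
  qed
  finally have "distr ?M (PiM ?I (\<lambda>_. borel)) (\<lambda>w. \<lambda>ij\<in>?I. w ij) = PiM ?I (\<lambda>ij. distr ?M borel (\<lambda>w. w ij))" .
  moreover have "?I \<noteq> {}" using assms by auto
  moreover have "random_variable borel (\<lambda>w. w ij)" if "ij \<in> ?I" for ij
    using that entry_measurable by auto
  ultimately show ?thesis by (subst indep_vars_iff_distr_eq_PiM') auto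
qed

lemma distributed_row_dot:
  assumes m: "m > 0" "i < m" and z: "(\<Sum>k<n. (z k)\<^sup>2) > 0"
  shows "distributed (gaussian_entries m n) lborel (\<lambda>w. row_dot w n i z)
    (normal_density 0 (sqrt ((\<Sum>k<n. (z k)\<^sup>2) / m)))"
proof -
  let ?M = "gaussian_entries m n"
  interpret prob_space ?M using assms by (intro prob_space_gaussian_entries) simp
  \<comment> \<open>Zero coordinates are left out so that every summand is normal with positive
    standard deviation.\<close>
  define S where "S = {k. k < n \<and> z k \<noteq> 0}"
  have "(\<Sum>k<n. (z k)\<^sup>2) = 0" if "S = {}"
    using that by (intro sum.neutral) (auto simp: S_def)
  then have S: "finite S" "S \<noteq> {}" "S \<subseteq> {..<n}"
    using z unfolding S_def by fastforce+
  have n: "n > 0" using S by auto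
  have "indep_vars (\<lambda>_. borel) (\<lambda>ij w. w ij) ({i} \<times> S)"
    by (rule indep_vars_subset[OF indep_entries[OF m(1) n]]) (use S m in auto)
  then have ind: "indep_vars (\<lambda>_. borel) (\<lambda>ij w. z (snd ij) * w ij) ({i} \<times> S)"
    by (rule indep_vars_compose2) auto
  have "distributed ?M lborel (\<lambda>w. \<Sum>ij\<in>{i} \<times> S. z (snd ij) * w ij)
    (normal_density (\<Sum>ij\<in>{i} \<times> S. 0) (sqrt (\<Sum>ij\<in>{i} \<times> S. (\<bar>z (snd ij)\<bar> * sqrt (1 / m))\<^sup>2)))"
  proof (rule sum_indep_normal[OF _ _ ind])
    fix ij assume ij: "ij \<in> {i} \<times> S"
    then have nz: "z (snd ij) \<noteq> 0" by (auto simp: S_def)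
    then show "0 < \<bar>z (snd ij)\<bar> * sqrt (1 / m)" using m by simp
    have "distributed ?M lborel (\<lambda>w. w ij) (normal_density 0 (sqrt (1 / m)))"
      unfolding distributed_def
    proof (intro conjI)
      show "distr ?M lborel (\<lambda>w. w ij) = gauss (sqrt (1 / m))"
        using distr_entry[of ij m n] ij S m by (subst distr_cong[OF refl sets_lborel refl]) auto
      show "(\<lambda>w. w ij) \<in> measurable ?M lborel" using ij S m entry_measurable[of i m _ n] by auto
    qed simp
    from normal_density_affine[OF this _ nz, of 0] m
    show "distributed ?M lborel (\<lambda>w. z (snd ij) * w ij) (normal_density 0 (\<bar>z (snd ij)\<bar> * sqrt (1 / m)))"
      by simp
  qed (use S in auto)
  also have "(\<lambda>w. \<Sum>ij\<in>{i} \<times> S. z (snd ij) * w ij) = (\<lambda>w. row_dot w n i z)"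
  proof
    fix w
    have "(\<Sum>ij\<in>{i} \<times> S. z (snd ij) * w ij) = (\<Sum>k\<in>S. w (i, k) * z k)"
      by (rule sum.reindex_bij_witness[of _ "\<lambda>k. (i, k)" snd]) auto
    also have "\<dots> = row_dot w n i z" unfolding row_dot_def
      by (rule sum.mono_neutral_left) (use S in \<open>auto simp: S_def\<close>)
    finally show "(\<Sum>ij\<in>{i} \<times> S. z (snd ij) * w ij) = row_dot w n i z" .
  qed
  also have "(\<Sum>ij\<in>{i} \<times> S. (\<bar>z (snd ij)\<bar> * sqrt (1 / m))\<^sup>2) = (\<Sum>k<n. (z k)\<^sup>2) / m"
  proof -
    have "(\<Sum>ij\<in>{i} \<times> S. (\<bar>z (snd ij)\<bar> * sqrt (1 / m))\<^sup>2) = (\<Sum>k\<in>S. (z k)\<^sup>2 / m)"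
      by (rule sum.reindex_bij_witness[of _ "\<lambda>k. (i, k)" snd]) (auto simp: power_mult_distrib)
    also have "\<dots> = (\<Sum>k<n. (z k)\<^sup>2 / m)"
      by (rule sum.mono_neutral_left) (use S in \<open>auto simp: S_def\<close>)
    finally show ?thesis by (simp add: sum_divide_distrib)
  qed
  finally show ?thesis by simp
qed

text \<open>Different rows use disjoint sets of entries, so their products with \<open>z\<close> are
  independent, and they share one law.\<close>

lemma nn_integral_prod_rows:
  fixes f :: "real \<Rightarrow> ennreal"
  assumes m: "m > 0" and z: "(\<Sum>k<n. (z k)\<^sup>2) > 0" and f [measurable]: "f \<in> borel_measurable borel"
  shows "(\<integral>\<^sup>+w. (\<Prod>i<m. f (row_dot w n i z)) \<partial>gaussian_entries m n)
    = (\<integral>\<^sup>+x. normal_density 0 (sqrt ((\<Sum>k<n. (z k)\<^sup>2) / m)) x * f x \<partial>lborel) ^ m"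
proof -
  let ?M = "gaussian_entries m n"
  interpret prob_space ?M using assms by (intro prob_space_gaussian_entries) simp
  have n: "n > 0" using z by (cases n) auto
  have "indep_vars (\<lambda>i. PiM ({i} \<times> {..<n}) (\<lambda>_. borel))
    (\<lambda>i w. restrict (\<lambda>ij. w ij) ({i} \<times> {..<n})) {..<m}"
    by (rule indep_vars_restrict[OF indep_entries[OF m n]]) (auto simp: disjoint_family_on_def)
  then have "indep_vars (\<lambda>_. borel) (\<lambda>i w. f (\<Sum>k<n. restrict (\<lambda>ij. w ij) ({i} \<times> {..<n}) (i, k) * z k)) {..<m}"
    by (rule indep_vars_compose2[where Y = "\<lambda>i y. f (\<Sum>k<n. y (i, k) * z k)"]) measurable
  also have "(\<lambda>i w. f (\<Sum>k<n. restrict (\<lambda>ij. w ij) ({i} \<times> {..<n}) (i, k) * z k))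
    = (\<lambda>i w. f (row_dot w n i z))"
    by (simp add: row_dot_def)
  finally have "(\<integral>\<^sup>+w. (\<Prod>i<m. f (row_dot w n i z)) \<partial>?M) = (\<Prod>i<m. \<integral>\<^sup>+w. f (row_dot w n i z) \<partial>?M)"
    by (intro indep_vars_nn_integral) auto
  also have "\<dots> = (\<Prod>i<m. \<integral>\<^sup>+x. normal_density 0 (sqrt ((\<Sum>k<n. (z k)\<^sup>2) / m)) x * f x \<partial>lborel)"
    using m z by (intro prod.cong refl distributed_nn_integral[symmetric] distributed_row_dot) auto
  finally show ?thesis by simp
qed

section \<open>Exponential moments and tail bounds for Gaussian rows\<close>

lemma nn_integral_normal_density: "\<sigma> > 0 \<Longrightarrow> (\<integral>\<^sup>+x. ennreal (normal_density \<mu> \<sigma> x) \<partial>lborel) = 1"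
  by (simp add: nn_integral_eq_integral)

text \<open>The tilted density is \<open>sqrt 2\<close> times the normal density with doubled
  variance.\<close>

lemma gauss_square_exponential:
  assumes "\<sigma> > 0"
  shows "(\<integral>\<^sup>+x. ennreal (normal_density 0 \<sigma> x) * ennreal (exp (x\<^sup>2 / (4 * \<sigma>\<^sup>2))) \<partial>lborel) = ennreal (sqrt 2)"
proof -
  have "normal_density 0 \<sigma> x * exp (x\<^sup>2 / (4 * \<sigma>\<^sup>2)) = sqrt 2 * normal_density 0 (sqrt 2 * \<sigma>) x" for x
  proof -
    have "exp (- (x\<^sup>2 / (2 * \<sigma>\<^sup>2))) * exp (x\<^sup>2 / (4 * \<sigma>\<^sup>2)) = exp (- (x\<^sup>2 / (4 * \<sigma>\<^sup>2)))"
      using assms unfolding exp_add[symmetric] by (simp add: field_simps)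
    then show ?thesis using assms
      by (simp add: normal_density_def real_sqrt_mult power_mult_distrib field_simps)
  qed
  then have "(\<integral>\<^sup>+x. ennreal (normal_density 0 \<sigma> x) * ennreal (exp (x\<^sup>2 / (4 * \<sigma>\<^sup>2))) \<partial>lborel)
    = (\<integral>\<^sup>+x. ennreal (sqrt 2) * ennreal (normal_density 0 (sqrt 2 * \<sigma>) x) \<partial>lborel)"
    by (intro nn_integral_cong) (simp add: ennreal_mult[symmetric])
  also have "\<dots> = ennreal (sqrt 2)"
    using assms by (subst nn_integral_cmult) (auto simp: nn_integral_normal_density)
  finally show ?thesis .
qed

text \<open>The density is at most \<open>1 / (2 * \<sigma>)\<close>, so an interval of length
  \<open>2 * \<delta> * \<sigma>\<close> carries mass at most \<open>\<delta>\<close>; weighting it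
  by \<open>1 / \<delta>\<close> adds at most 1 to the total mass.\<close>

lemma gauss_small_ball:
  assumes s: "\<sigma> > 0" and d: "0 < \<delta>"
  shows "(\<integral>\<^sup>+x. ennreal (normal_density 0 \<sigma> x) * ennreal (if \<bar>x\<bar> \<le> \<delta> * \<sigma> then 1 / \<delta> else 1) \<partial>lborel) \<le> 2"
proof -
  have dens: "normal_density 0 \<sigma> x \<le> 1 / (2 * \<sigma>)" for x
  proof -
    have "2 * \<sigma> \<le> sqrt (2 * pi) * \<sigma>"
      using s pi_ge_two by (intro mult_right_mono real_le_rsqrt) auto
    then have "sqrt (2 * pi * \<sigma>\<^sup>2) \<ge> 2 * \<sigma>" using s by (simp add: real_sqrt_mult)
    then have "1 / sqrt (2 * pi * \<sigma>\<^sup>2) \<le> 1 / (2 * \<sigma>)" using s by (intro divide_left_mono) auto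
    moreover have "exp (- (x\<^sup>2 / (2 * \<sigma>\<^sup>2))) \<le> 1" by simp
    ultimately have "1 / sqrt (2 * pi * \<sigma>\<^sup>2) * exp (- (x\<^sup>2 / (2 * \<sigma>\<^sup>2))) \<le> 1 / (2 * \<sigma>) * 1"
      using s by (intro mult_mono) auto
    then show ?thesis by (simp add: normal_density_def)
  qed
  have "(\<integral>\<^sup>+x. ennreal (normal_density 0 \<sigma> x) * ennreal (if \<bar>x\<bar> \<le> \<delta> * \<sigma> then 1 / \<delta> else 1) \<partial>lborel)
    \<le> (\<integral>\<^sup>+x. ennreal (normal_density 0 \<sigma> x) + ennreal (1 / (2 * \<sigma> * \<delta>)) * indicator {- (\<delta> * \<sigma>)..\<delta> * \<sigma>} x \<partial>lborel)"
  proof (intro nn_integral_mono)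
    fix x
    have "normal_density 0 \<sigma> x * (1 / \<delta>) \<le> normal_density 0 \<sigma> x + 1 / (2 * \<sigma> * \<delta>)"
    proof -
      have "normal_density 0 \<sigma> x * (1 / \<delta>) \<le> 1 / (2 * \<sigma>) * (1 / \<delta>)"
        using d by (intro mult_right_mono dens) auto
      also have "\<dots> = 1 / (2 * \<sigma> * \<delta>)" by simp
      finally show ?thesis using normal_density_nonneg[of 0 \<sigma> x] by linarith
    qed
    then show "ennreal (normal_density 0 \<sigma> x) * ennreal (if \<bar>x\<bar> \<le> \<delta> * \<sigma> then 1 / \<delta> else 1)
      \<le> ennreal (normal_density 0 \<sigma> x) + ennreal (1 / (2 * \<sigma> * \<delta>)) * indicator {- (\<delta> * \<sigma>)..\<delta> * \<sigma>} x"
      using s d by (auto simp: indicator_def ennreal_mult[symmetric] ennreal_plus[symmetric] abs_le_iff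
          simp del: ennreal_plus intro!: ennreal_leI)
  qed
  also have "\<dots> = 1 + ennreal (1 / (2 * \<sigma> * \<delta>)) * ennreal (2 * (\<delta> * \<sigma>))"
    using s d by (subst nn_integral_add) (auto simp: nn_integral_cmult_indicator nn_integral_normal_density)
  also have "\<dots> = 2" using s d
    by (simp add: ennreal_mult[symmetric] field_simps)
  finally show ?thesis .
qed

lemma (in prob_space) markov_product_bound:
  fixes f :: "'a \<Rightarrow> ennreal"
  assumes f [measurable]: "f \<in> borel_measurable M"
    and int: "(\<integral>\<^sup>+w. f w \<partial>M) \<le> ennreal b" and b: "0 \<le> b" and c: "c > 0"
    and sub: "\<And>w. w \<in> space M \<Longrightarrow> E w \<Longrightarrow> ennreal c \<le> f w"
    and E [measurable]: "Measurable.pred M E"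
  shows "prob {w \<in> space M. E w} \<le> b / c"
proof -
  have "ennreal c * emeasure M {w \<in> space M. E w} = (\<integral>\<^sup>+w. ennreal c * indicator {w \<in> space M. E w} w \<partial>M)"
    by (simp add: nn_integral_cmult_indicator)
  also have "\<dots> \<le> (\<integral>\<^sup>+w. f w \<partial>M)"
    by (intro nn_integral_mono) (auto simp: indicator_def sub)
  also have "\<dots> \<le> ennreal b" by (rule int)
  finally have "ennreal (c * prob {w \<in> space M. E w}) \<le> ennreal b"
    using c by (simp add: emeasure_eq_measure ennreal_mult)
  then show ?thesis using c b by (simp add: field_simps)
qed

text \<open>Chernoff bound: each row product has variance \<open>1 / m\<close>, so energy at least 4
  makes the product of exponentials at least \<open>exp m\<close>, against an expectation of
  \<open>sqrt 2 ^ m \<le> exp (m / 2)\<close>.\<close>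

lemma energy_tail:
  assumes m: "m > 0" and z: "(\<Sum>k<n. (z k)\<^sup>2) = 1"
  shows "\<P>(w in gaussian_entries m n. (\<Sum>i<m. (row_dot w n i z)\<^sup>2) \<ge> 4) \<le> exp (- (real m / 2))"
proof -
  let ?M = "gaussian_entries m n"
  interpret prob_space ?M using assms by (intro prob_space_gaussian_entries) simp
  define \<sigma> where "\<sigma> = sqrt (1 / m)"
  have s: "\<sigma> > 0" "\<sigma>\<^sup>2 = 1 / m" using m by (auto simp: \<sigma>_def)
  note [measurable] = row_dot_measurable
  have "prob {w \<in> space ?M. (\<Sum>i<m. (row_dot w n i z)\<^sup>2) \<ge> 4} \<le> sqrt 2 ^ m / exp (real m)"
  proof (rule markov_product_bound)
    show "(\<lambda>w. \<Prod>i<m. ennreal (exp ((row_dot w n i z)\<^sup>2 / (4 * \<sigma>\<^sup>2)))) \<in> borel_measurable ?M"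
      by measurable
    show "(\<integral>\<^sup>+w. (\<Prod>i<m. ennreal (exp ((row_dot w n i z)\<^sup>2 / (4 * \<sigma>\<^sup>2)))) \<partial>?M) \<le> ennreal (sqrt 2 ^ m)"
      using nn_integral_prod_rows[where f = "\<lambda>x. ennreal (exp (x\<^sup>2 / (4 * \<sigma>\<^sup>2)))", of m z n] m z
        gauss_square_exponential[OF s(1)]
      by (simp add: \<sigma>_def[symmetric] ennreal_power)
    show "Measurable.pred ?M (\<lambda>w. (\<Sum>i<m. (row_dot w n i z)\<^sup>2) \<ge> 4)" by measurable
  next
    fix w assume "(\<Sum>i<m. (row_dot w n i z)\<^sup>2) \<ge> 4"
    then have "real m * 4 / 4 \<le> real m * (\<Sum>i<m. (row_dot w n i z)\<^sup>2) / 4"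
      by (intro divide_right_mono mult_left_mono) auto
    also have "\<dots> = (\<Sum>i<m. (row_dot w n i z)\<^sup>2 / (4 * \<sigma>\<^sup>2))"
      by (simp add: s sum_divide_distrib sum_distrib_left mult.commute)
    finally have "exp (real m) \<le> (\<Prod>i<m. exp ((row_dot w n i z)\<^sup>2 / (4 * \<sigma>\<^sup>2)))"
      by (simp add: exp_sum[symmetric])
    then show "ennreal (exp (real m)) \<le> (\<Prod>i<m. ennreal (exp ((row_dot w n i z)\<^sup>2 / (4 * \<sigma>\<^sup>2))))"
      by (subst prod_ennreal) (auto intro!: ennreal_leI)
  qed auto
  also have "sqrt 2 ^ m \<le> exp (1 / 2) ^ m"
  proof (intro power_mono real_le_lsqrt)
    have "(2::real) \<le> exp 1" using exp_ge_add_one_self[of 1] by simp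
    also have "exp 1 = (exp (1 / 2 :: real))\<^sup>2" by (simp add: exp_double[symmetric])
    finally show "2 \<le> (exp (1 / 2 :: real))\<^sup>2" .
  qed auto
  also have "exp (1 / 2) ^ m / exp (real m) = exp (- (real m / 2))"
    by (simp add: exp_of_nat_mult[symmetric] exp_diff[symmetric] field_simps)
  finally show ?thesis by (simp add: divide_right_mono)
qed

text \<open>Rewarding each small row with a factor \<open>exp 12\<close> makes the product at least
  \<open>exp (3 * m)\<close> once a quarter of the rows is small, against an expectation of at most
  \<open>2 ^ m\<close>. The tiny threshold buys the decay that the union over signed lists
  consumes.\<close>

lemma small_rows_tail:
  assumes m: "m > 0" and z: "(\<Sum>k<n. (z k)\<^sup>2) > 0"
  shows "\<P>(w in gaussian_entries m n.
      real (card {i. i < m \<and> \<bar>row_dot w n i z\<bar> \<le> exp (- 12) * sqrt ((\<Sum>k<n. (z k)\<^sup>2) / m)}) \<ge> m / 4)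
    \<le> exp (- (2 * real m))"
proof -
  let ?M = "gaussian_entries m n"
  interpret prob_space ?M using assms by (intro prob_space_gaussian_entries) simp
  define \<sigma> where "\<sigma> = sqrt ((\<Sum>k<n. (z k)\<^sup>2) / m)"
  have s: "\<sigma> > 0" using m z by (auto simp: \<sigma>_def)
  define g :: "real \<Rightarrow> real" where "g x = (if \<bar>x\<bar> \<le> exp (- 12) * \<sigma> then 1 / exp (- 12) else 1)" for x
  have [measurable]: "g \<in> borel_measurable borel" unfolding g_def by measurable
  note [measurable] = row_dot_measurable
  have card: "real (card {i. i < m \<and> \<bar>row_dot w n i z\<bar> \<le> exp (- 12) * \<sigma>})
    = (\<Sum>i<m. if \<bar>row_dot w n i z\<bar> \<le> exp (- 12) * \<sigma> then 1 else 0)" for w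
    by (simp add: sum.If_cases Int_def)
  have "prob {w \<in> space ?M. real (card {i. i < m \<and> \<bar>row_dot w n i z\<bar> \<le> exp (- 12) * \<sigma>}) \<ge> m / 4}
    \<le> 2 ^ m / exp (3 * real m)"
  proof (rule markov_product_bound)
    show "(\<lambda>w. \<Prod>i<m. ennreal (g (row_dot w n i z))) \<in> borel_measurable ?M" by measurable
    show "(\<integral>\<^sup>+w. (\<Prod>i<m. ennreal (g (row_dot w n i z))) \<partial>?M) \<le> ennreal (2 ^ m)"
      using nn_integral_prod_rows[where f = "\<lambda>x. ennreal (g x)", of m z n] m z
        power_mono[OF gauss_small_ball[OF s, of "exp (- 12)"], of m]
      by (simp add: \<sigma>_def[symmetric] ennreal_power[symmetric] g_def[abs_def])
    show "Measurable.pred ?M (\<lambda>w. m / 4 \<le> real (card {i. i < m \<and> \<bar>row_dot w n i z\<bar> \<le> exp (- 12) * \<sigma>}))"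
      unfolding card by measurable
  next
    fix w assume "m / 4 \<le> real (card {i. i < m \<and> \<bar>row_dot w n i z\<bar> \<le> exp (- 12) * \<sigma>})"
    then have "3 * real m \<le> 12 * (\<Sum>i<m. if \<bar>row_dot w n i z\<bar> \<le> exp (- 12) * \<sigma> then 1 else 0 :: real)"
      unfolding card by linarith
    also have "\<dots> = (\<Sum>i<m. if \<bar>row_dot w n i z\<bar> \<le> exp (- 12) * \<sigma> then 12 else 0)"
      unfolding sum_distrib_left by (intro sum.cong) auto
    finally have "exp (3 * real m) \<le> exp (\<Sum>i<m. if \<bar>row_dot w n i z\<bar> \<le> exp (- 12) * \<sigma> then 12 else 0)" by simp
    also have "\<dots> = (\<Prod>i<m. g (row_dot w n i z))"
      by (subst exp_sum) (auto intro!: prod.cong simp: g_def exp_minus field_simps)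
    finally show "ennreal (exp (3 * real m)) \<le> (\<Prod>i<m. ennreal (g (row_dot w n i z)))"
      by (subst prod_ennreal) (auto simp: g_def intro!: ennreal_leI)
  qed auto
  also have "(2::real) ^ m \<le> exp 1 ^ m"
    using exp_ge_add_one_self[of "1::real"] by (intro power_mono) auto
  also have "(exp 1 :: real) ^ m / exp (3 * real m) = exp (- (2 * real m))"
    by (simp add: exp_of_nat_mult[symmetric] exp_diff[symmetric] field_simps)
  finally show ?thesis by (simp add: divide_right_mono \<sigma>_def)
qed

section \<open>Vectors orthogonal to many rows\<close>

definition atom :: "nat \<Rightarrow> nat set \<Rightarrow> nat \<Rightarrow> nat \<Rightarrow> real" where
  "atom n Q i k = indicator (run n Q i) k / sqrt (card (run n Q i))"

definition signed_sum :: "nat \<Rightarrow> nat set \<Rightarrow> (nat \<times> real) list \<Rightarrow> nat \<Rightarrow> real" where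
  "signed_sum n Q ps k = (\<Sum>(i, \<sigma>)\<leftarrow>ps. \<sigma> * atom n Q i k)"

definition signed_lists :: "nat \<Rightarrow> nat \<Rightarrow> (nat \<times> real) list set" where
  "signed_lists n L = {ps. length ps = L \<and> set ps \<subseteq> {..<n} \<times> {-1, 1}}"

lemma card_run_pos: "i < n \<Longrightarrow> card (run n Q i) > 0"
  using run_self[of i n Q] by (auto simp: card_gt_0_iff)

lemma atom_sqnorm: "i < n \<Longrightarrow> sqnorm {..<n} (atom n Q i) = 1"
proof -
  assume i: "i < n"
  have "sqnorm {..<n} (atom n Q i) = (\<Sum>k<n. indicator (run n Q i) k / card (run n Q i))"
    unfolding sqnorm_def atom_def
    by (intro sum.cong refl) (auto simp: power_divide indicator_def)
  also have "\<dots> = (\<Sum>k\<in>run n Q i. 1 / card (run n Q i))"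
    by (intro sum.mono_neutral_cong_right) (auto simp: run_def indicator_def)
  also have "\<dots> = 1" using card_run_pos[OF i, of Q] by (auto simp: card_gt_0_iff)
  finally show ?thesis .
qed

lemma finite_signed_lists: "finite (signed_lists n L)"
  and card_signed_lists: "card (signed_lists n L) = (2 * n) ^ L"
proof -
  have fin: "finite ({..<n} \<times> {-1, 1 :: real})" by simp
  have c: "card ({..<n} \<times> {-1, 1 :: real}) = 2 * n" by (simp add: card_cartesian_product)
  have eq: "signed_lists n L = {ps. set ps \<subseteq> {..<n} \<times> {-1, 1} \<and> length ps = L}"
    unfolding signed_lists_def by auto
  show "finite (signed_lists n L)" "card (signed_lists n L) = (2 * n) ^ L"
    unfolding eq using finite_lists_length_eq[OF fin, of L] card_lists_length_eq[OF fin, of L] c by auto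
qed

lemma row_dot_scale: "row_dot w n i (\<lambda>k. c * z k) = c * row_dot w n i z"
  by (simp add: row_dot_def sum_distrib_left mult_ac)

lemma row_dot_sum: "row_dot w n i (\<lambda>k. \<Sum>p\<in>P. f p k) = (\<Sum>p\<in>P. row_dot w n i (f p))"
  unfolding row_dot_def sum_distrib_left by (rule sum.swap)

lemma row_dot_sum_list: "row_dot w n i (\<lambda>k. \<Sum>p\<leftarrow>ps. f p k) = (\<Sum>p\<leftarrow>ps. row_dot w n i (f p))"
  by (induction ps) (auto simp: row_dot_def sum.distrib distrib_left)

lemma row_dot_cong: "(\<And>k. k < n \<Longrightarrow> z k = z' k) \<Longrightarrow> row_dot w n i z = row_dot w n i z'"
  by (simp add: row_dot_def)

text \<open>Maurey's method is run in \<open>n + m\<close> dimensions, with the entries of a vector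
  and its row products as coordinates, so that one list controls both errors. An atom then has
  squared length at most \<open>1 + 4 = 5\<close>. Averages are multiplied by \<open>L\<close> to
  become signed sums.\<close>

lemma sparse_approximation:
  assumes Q: "0 \<in> Q" and n: "n > 0"
    and l1: "(\<Sum>i<n. \<bar>run_coeff Q u i\<bar> * sqrt (card (run n Q i))) = 1"
    and energy: "\<And>i. i < n \<Longrightarrow> (\<Sum>j<m. (row_dot w n j (atom n Q i))\<^sup>2) \<le> 4"
  shows "\<exists>ps\<in>signed_lists n L. (\<Sum>k<n. (signed_sum n Q ps k - L * u k)\<^sup>2)
    + (\<Sum>j<m. (row_dot w n j (signed_sum n Q ps) - L * row_dot w n j u)\<^sup>2) \<le> 5 * L"
proof -
  \<comment> \<open>The signs of the coefficients move into the atoms, which leaves the convex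
    weights \<open>lam\<close>.\<close>
  define \<sigma> :: "nat \<Rightarrow> real" where "\<sigma> i = (if run_coeff Q u i < 0 then -1 else 1)" for i
  define lam where "lam i = \<bar>run_coeff Q u i\<bar> * sqrt (card (run n Q i))" for i
  define b where "b i k = \<sigma> i * atom n Q i k" for i k
  define V where "V i x = (case x of Inl k \<Rightarrow> b i k | Inr j \<Rightarrow> row_dot w n j (b i))" for i and x :: "nat + nat"
  define U where "U x = (case x of Inl k \<Rightarrow> u k | Inr j \<Rightarrow> row_dot w n j u)" for x :: "nat + nat"
  have \<sigma>2: "(\<sigma> i)\<^sup>2 = 1" for i by (simp add: \<sigma>_def)
  have udec: "u k = (\<Sum>i<n. lam i * b i k)" if "k < n" for k
  proof -
    have "u k = (\<Sum>i<n. run_coeff Q u i * indicator (run n Q i) k)"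
      by (rule run_decomposition[OF Q that])
    also have "\<dots> = (\<Sum>i<n. lam i * b i k)"
    proof (rule sum.cong)
      fix i assume "i \<in> {..<n}"
      then have "sqrt (card (run n Q i)) \<noteq> 0" using card_run_pos[of i n Q] by (auto simp: card_gt_0_iff)
      moreover have "run_coeff Q u i = \<bar>run_coeff Q u i\<bar> * \<sigma> i" by (simp add: \<sigma>_def)
      ultimately show "run_coeff Q u i * indicator (run n Q i) k = lam i * b i k"
        by (simp add: lam_def b_def atom_def)
    qed simp
    finally show ?thesis .
  qed
  have rdec: "row_dot w n j u = (\<Sum>i<n. lam i * row_dot w n j (b i))" for j
  proof -
    have "row_dot w n j u = row_dot w n j (\<lambda>k. \<Sum>i<n. lam i * b i k)"
      by (rule row_dot_cong) (rule udec)
    then show ?thesis by (simp add: row_dot_sum row_dot_scale)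
  qed
  have "\<exists>ps. length ps = L \<and> set ps \<subseteq> {..<n} \<and>
    (\<Sum>x\<in>{..<n} <+> {..<m}. ((\<Sum>p\<leftarrow>ps. V p x) - real L * U x)\<^sup>2) \<le> real L * 5"
  proof (rule maurey)
    show "(\<Sum>p\<in>{..<n}. lam p) = 1" using l1 by (simp add: lam_def)
    fix p assume p: "p \<in> {..<n}"
    show "0 \<le> lam p" by (simp add: lam_def)
    have "(\<Sum>x\<in>{..<n} <+> {..<m}. (V p x)\<^sup>2) = (\<Sum>k<n. (b p k)\<^sup>2) + (\<Sum>j<m. (row_dot w n j (b p))\<^sup>2)"
      by (subst sum.Plus) (auto simp: V_def)
    also have "\<dots> = (\<Sum>k<n. (atom n Q p k)\<^sup>2) + (\<Sum>j<m. (row_dot w n j (atom n Q p))\<^sup>2)"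
      by (simp add: b_def[abs_def] row_dot_scale power_mult_distrib \<sigma>2)
    also have "\<dots> \<le> 5" using atom_sqnorm[of p n Q] energy[of p] p by (simp add: sqnorm_def)
    finally show "(\<Sum>x\<in>{..<n} <+> {..<m}. (V p x)\<^sup>2) \<le> 5" .
  next
    fix x assume "x \<in> {..<n} <+> {..<m}"
    then show "U x = (\<Sum>p\<in>{..<n}. lam p * V p x)"
      by (auto simp: U_def V_def udec rdec)
  qed auto
  then obtain js where js: "length js = L" "set js \<subseteq> {..<n}"
    "(\<Sum>x\<in>{..<n} <+> {..<m}. ((\<Sum>p\<leftarrow>js. V p x) - real L * U x)\<^sup>2) \<le> real L * 5" by blast
  define ps where "ps = map (\<lambda>i. (i, \<sigma> i)) js"
  have ss: "signed_sum n Q ps = (\<lambda>k. \<Sum>i\<leftarrow>js. b i k)"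
    by (simp add: fun_eq_iff signed_sum_def ps_def b_def comp_def)
  have "ps \<in> signed_lists n L" using js by (auto simp: signed_lists_def ps_def \<sigma>_def)
  moreover have "(\<Sum>x\<in>{..<n} <+> {..<m}. ((\<Sum>p\<leftarrow>js. V p x) - real L * U x)\<^sup>2)
    = (\<Sum>k<n. (signed_sum n Q ps k - L * u k)\<^sup>2)
    + (\<Sum>j<m. (row_dot w n j (signed_sum n Q ps) - L * row_dot w n j u)\<^sup>2)"
    unfolding ss row_dot_sum_list by (subst sum.Plus) (auto simp: V_def U_def)
  ultimately show ?thesis using js(3) by (auto intro!: bexI[of _ ps])
qed

section \<open>The good event and its probability\<close>

definition small_rows :: "nat \<Rightarrow> nat \<Rightarrow> (nat \<times> nat \<Rightarrow> real) \<Rightarrow> (nat \<Rightarrow> real) \<Rightarrow> nat set" where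
  "small_rows m n w z = {i. i < m \<and> \<bar>row_dot w n i z\<bar> \<le> exp (- 12) * sqrt (sqnorm {..<n} z / m)}"

text \<open>Both conditions negate tail events, so the complement is a finite union of events with
  bounded probability. Vanishing signed sums are excluded: their threshold is 0 and every row would
  count as small.\<close>

definition good_entries :: "nat \<Rightarrow> nat \<Rightarrow> nat set \<Rightarrow> nat \<Rightarrow> (nat \<times> nat \<Rightarrow> real) \<Rightarrow> bool" where
  "good_entries m n Q L w \<longleftrightarrow>
    (\<forall>i<n. \<not> 4 \<le> (\<Sum>j<m. (row_dot w n j (atom n Q i))\<^sup>2)) \<and>
    (\<forall>ps\<in>signed_lists n L. sqnorm {..<n} (signed_sum n Q ps) > 0 \<longrightarrow>
      \<not> m / 4 \<le> real (card (small_rows m n w (signed_sum n Q ps))))"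

lemma not_good_entries_eq:
  "{w \<in> space (gaussian_entries m n). \<not> good_entries m n Q L w} =
    (\<Union>i<n. {w \<in> space (gaussian_entries m n). 4 \<le> (\<Sum>j<m. (row_dot w n j (atom n Q i))\<^sup>2)}) \<union>
    (\<Union>ps\<in>{ps \<in> signed_lists n L. sqnorm {..<n} (signed_sum n Q ps) > 0}.
      {w \<in> space (gaussian_entries m n). m / 4 \<le> real (card (small_rows m n w (signed_sum n Q ps)))})"
  by (auto simp: good_entries_def)

lemma energy_event:
  "{w \<in> space (gaussian_entries m n). 4 \<le> (\<Sum>j<m. (row_dot w n j z)\<^sup>2)} \<in> sets (gaussian_entries m n)"
proof -
  note [measurable] = row_dot_measurable
  show ?thesis by measurable
qed

lemma small_rows_event:
  "{w \<in> space (gaussian_entries m n). m / 4 \<le> real (card (small_rows m n w z))} \<in> sets (gaussian_entries m n)"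
proof -
  note [measurable] = row_dot_measurable
  have card: "real (card (small_rows m n w z))
    = (\<Sum>i<m. if \<bar>row_dot w n i z\<bar> \<le> exp (- 12) * sqrt (sqnorm {..<n} z / m) then 1 else 0)" for w
    by (simp add: small_rows_def sum.If_cases Int_def)
  show ?thesis unfolding card by measurable
qed

lemma not_good_entries_event:
  "{w \<in> space (gaussian_entries m n). \<not> good_entries m n Q L w} \<in> sets (gaussian_entries m n)"
  unfolding not_good_entries_eq
  by (intro sets.Un sets.finite_UN energy_event small_rows_event) (auto simp: finite_signed_lists)

lemma prob_not_good_entries:
  assumes m: "m > 0"
  shows "\<P>(w in gaussian_entries m n. \<not> good_entries m n Q L w)
    \<le> n * exp (- (real m / 2)) + (2 * real n) ^ L * exp (- (2 * real m))"
proof -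
  let ?M = "gaussian_entries m n"
  interpret prob_space ?M using m by (rule prob_space_gaussian_entries)
  let ?E1 = "\<lambda>i. {w \<in> space ?M. 4 \<le> (\<Sum>j<m. (row_dot w n j (atom n Q i))\<^sup>2)}"
  let ?E2 = "\<lambda>ps. {w \<in> space ?M. m / 4 \<le> real (card (small_rows m n w (signed_sum n Q ps)))}"
  define S where "S = {ps \<in> signed_lists n L. sqnorm {..<n} (signed_sum n Q ps) > 0}"
  have S: "finite S" "card S \<le> (2 * n) ^ L"
    using finite_signed_lists[of n L] card_signed_lists[of n L] card_mono[of "signed_lists n L" S]
    by (auto simp: S_def)
  have "prob {w \<in> space ?M. \<not> good_entries m n Q L w} = prob ((\<Union>i<n. ?E1 i) \<union> (\<Union>ps\<in>S. ?E2 ps))"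
    unfolding not_good_entries_eq S_def ..
  also have "\<dots> \<le> prob (\<Union>i<n. ?E1 i) + prob (\<Union>ps\<in>S. ?E2 ps)"
    using S by (intro measure_Un_le sets.finite_UN energy_event small_rows_event) simp_all
  also have "prob (\<Union>i<n. ?E1 i) \<le> (\<Sum>i<n. prob (?E1 i))"
    by (intro finite_measure_subadditive_finite image_subsetI energy_event) simp
  also have "\<dots> \<le> (\<Sum>i<n. exp (- (real m / 2)))"
    using m atom_sqnorm by (intro sum_mono energy_tail) (auto simp: sqnorm_def)
  also have "prob (\<Union>ps\<in>S. ?E2 ps) \<le> (\<Sum>ps\<in>S. prob (?E2 ps))"
    using S by (intro finite_measure_subadditive_finite image_subsetI small_rows_event)
  also have "\<dots> \<le> (\<Sum>ps\<in>S. exp (- (2 * real m)))"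
  proof (rule sum_mono)
    fix ps assume "ps \<in> S"
    then have "(\<Sum>k<n. (signed_sum n Q ps k)\<^sup>2) > 0" by (simp add: S_def sqnorm_def)
    from small_rows_tail[OF m this] show "prob (?E2 ps) \<le> exp (- (2 * real m))"
      by (simp only: small_rows_def sqnorm_def)
  qed
  also have "\<dots> = card S * exp (- (2 * real m))" by simp
  also have "\<dots> \<le> (2 * real n) ^ L * exp (- (2 * real m))"
  proof (rule mult_right_mono)
    have "real (card S) \<le> real ((2 * n) ^ L)" using S(2) by (rule of_nat_mono)
    then show "real (card S) \<le> (2 * real n) ^ L" by simp
  qed simp
  finally show ?thesis by simp
qed

text \<open>Let \<open>v\<close> be \<open>u\<close> scaled to coefficient norm 1, and
  \<open>z\<close> the approximation of \<open>L * v\<close>. A row orthogonal to \<open>u\<close>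
  sees only the error \<open>z - L * v\<close>. If it is not small for \<open>z\<close>, it
  contributes at least \<open>\<tau>\<^sup>2\<close> to an error energy of at most
  \<open>5 * L\<close>, so at most \<open>m / 4\<close> rows are of this kind; fewer than
  \<open>m / 4\<close> rows are small for \<open>z\<close>.\<close>

lemma few_zero_rows:
  assumes Q: "0 \<in> Q" and n: "n > 0" and m: "m > 0" and good: "good_entries m n Q L w"
    and K: "K > 0" "80 * K\<^sup>2 * exp 24 \<le> L"
    and u: "sqnorm {..<n} u > 0"
      "(\<Sum>i<n. \<bar>run_coeff Q u i\<bar> * sqrt (card (run n Q i))) \<le> K * sqrt (sqnorm {..<n} u)"
  shows "real (card {i. i < m \<and> row_dot w n i u = 0}) < m / 2"
proof -
  define a where "a = (\<Sum>i<n. \<bar>run_coeff Q u i\<bar> * sqrt (card (run n Q i)))"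
  have a0: "a > 0"
  proof (rule ccontr)
    assume "\<not> a > 0"
    moreover have "a \<ge> 0" unfolding a_def by (intro sum_nonneg) simp
    ultimately have "a = 0" by simp
    then have "\<forall>i\<in>{..<n}. \<bar>run_coeff Q u i\<bar> * sqrt (card (run n Q i)) = 0"
      unfolding a_def by (subst (asm) sum_nonneg_eq_0_iff) auto
    then have "run_coeff Q u i = 0" if "i < n" for i using that card_run_pos[of i n Q] by auto
    then have "u k = 0" if "k < n" for k using run_decomposition[OF Q that, of u] by simp
    then show False using u(1) by (simp add: sqnorm_def)
  qed
  define v where "v k = u k / a" for k
  have cv: "run_coeff Q v i = run_coeff Q u i / a" for i
    by (simp add: run_coeff_def v_def diff_divide_distrib)
  have "(\<Sum>i<n. \<bar>run_coeff Q v i\<bar> * sqrt (card (run n Q i))) = a / a"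
    unfolding cv by (subst a_def, subst sum_divide_distrib) (use a0 in \<open>simp add: abs_divide\<close>)
  then have l1: "(\<Sum>i<n. \<bar>run_coeff Q v i\<bar> * sqrt (card (run n Q i))) = 1" using a0 by simp
  have "sqnorm {..<n} v = sqnorm {..<n} u / a\<^sup>2"
    by (simp add: sqnorm_def v_def power_divide sum_divide_distrib)
  moreover have "a\<^sup>2 \<le> K\<^sup>2 * sqnorm {..<n} u"
    using power_mono[OF u(2)[folded a_def], of 2] a0 by (simp add: power_mult_distrib)
  ultimately have "a\<^sup>2 * 1 \<le> a\<^sup>2 * (K\<^sup>2 * sqnorm {..<n} v)" using a0 by simp
  then have vK: "sqnorm {..<n} v \<ge> 1 / K\<^sup>2"
    using a0 K by (subst (asm) mult_le_cancel_left_pos) (auto simp: field_simps)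
  have L0: "real L > 0" using K by (meson exp_gt_zero less_le_trans mult_pos_pos zero_less_numeral zero_less_power)
  obtain ps where ps: "ps \<in> signed_lists n L"
    and app: "(\<Sum>k<n. (signed_sum n Q ps k - L * v k)\<^sup>2)
      + (\<Sum>j<m. (row_dot w n j (signed_sum n Q ps) - L * row_dot w n j v)\<^sup>2) \<le> 5 * L"
    using sparse_approximation[where m = m and w = w and L = L, OF Q n l1] good by (fastforce simp: good_entries_def)
  define z where "z = signed_sum n Q ps"
  have app1: "(\<Sum>k<n. (z k - L * v k)\<^sup>2) \<le> 5 * L"
    and app2: "(\<Sum>j<m. (row_dot w n j z - L * row_dot w n j v)\<^sup>2) \<le> 5 * L"
    using app sum_nonneg[of "{..<n}" "\<lambda>k. (z k - L * v k)\<^sup>2"]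
      sum_nonneg[of "{..<m}" "\<lambda>j. (row_dot w n j z - L * row_dot w n j v)\<^sup>2"]
    unfolding z_def by auto
  have LK: "20 * K\<^sup>2 \<le> L"
  proof -
    have "20 * K\<^sup>2 * 1 \<le> (80 * K\<^sup>2) * exp 24" by (intro mult_mono) auto
    then show ?thesis using K by linarith
  qed
  have zK: "sqnorm {..<n} z \<ge> L\<^sup>2 / (4 * K\<^sup>2)"
  proof -
    \<comment> \<open>Right side minus left side is the square of
      \<open>2 * z k - L * v k\<close>.\<close>
    have "(L * v k)\<^sup>2 \<le> 2 * (z k)\<^sup>2 + 2 * (z k - L * v k)\<^sup>2" for k
      using sum_squares_ge_zero[of "2 * z k - L * v k" 0] by (simp add: power2_eq_square algebra_simps)
    then have "(\<Sum>k<n. (L * v k)\<^sup>2) \<le> (\<Sum>k<n. 2 * (z k)\<^sup>2 + 2 * (z k - L * v k)\<^sup>2)"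
      by (rule sum_mono)
    also have "\<dots> = 2 * sqnorm {..<n} z + 2 * (\<Sum>k<n. (z k - L * v k)\<^sup>2)"
      by (simp add: sum.distrib sum_distrib_left sqnorm_def)
    finally have "L\<^sup>2 * sqnorm {..<n} v \<le> 2 * sqnorm {..<n} z + 10 * L"
      using app1 by (simp add: power_mult_distrib sum_distrib_left[symmetric] sqnorm_def)
    moreover have "L\<^sup>2 * (1 / K\<^sup>2) \<le> L\<^sup>2 * sqnorm {..<n} v" by (intro mult_left_mono vK) auto
    \<comment> \<open>The error takes half of \<open>L\<^sup>2 / K\<^sup>2\<close>; the other half
      equals twice the claimed lower bound.\<close>
    moreover have "10 * real L \<le> L\<^sup>2 / (2 * K\<^sup>2)"
    proof -
      have "real L * (20 * K\<^sup>2) \<le> real L * L" by (intro mult_left_mono LK) auto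
      then show ?thesis using K by (simp add: field_simps power2_eq_square)
    qed
    moreover have "real (L\<^sup>2) * (1 / K\<^sup>2) = 2 * (L\<^sup>2 / (2 * K\<^sup>2))" "real (L\<^sup>2) / (2 * K\<^sup>2) = 2 * (L\<^sup>2 / (4 * K\<^sup>2))"
      by (auto simp: field_simps)
    ultimately show ?thesis by linarith
  qed
  have z0: "sqnorm {..<n} z > 0" using zK L0 K by (auto intro: less_le_trans[rotated])
  then have small: "real (card (small_rows m n w z)) < m / 4"
    using good ps unfolding good_entries_def z_def by auto
  define Z where "Z = {i. i < m \<and> row_dot w n i u = 0}"
  define R where "R = Z - small_rows m n w z"
  have finR: "finite R" "finite Z" unfolding R_def Z_def by auto
  define \<tau> where "\<tau> = exp (- 12) * sqrt (sqnorm {..<n} z / m)"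
  have t2: "\<tau>\<^sup>2 = exp (- 24) * (sqnorm {..<n} z / m)"
    by (simp add: \<tau>_def power_mult_distrib exp_double[symmetric])
  have "\<tau>\<^sup>2 \<le> (row_dot w n i z - L * row_dot w n i v)\<^sup>2" if i: "i \<in> R" for i
  proof -
    have "row_dot w n i v = 0"
      using i row_dot_scale[of w n i "1 / a" u] unfolding R_def Z_def v_def by simp
    moreover have "\<tau> \<le> \<bar>row_dot w n i z\<bar>" using i unfolding R_def Z_def small_rows_def \<tau>_def by auto
    ultimately show ?thesis by (simp add: \<tau>_def abs_le_square_iff[symmetric])
  qed
  then have "card R * \<tau>\<^sup>2 \<le> (\<Sum>i\<in>R. (row_dot w n i z - L * row_dot w n i v)\<^sup>2)"
    using sum_mono[of R "\<lambda>_. \<tau>\<^sup>2"] by simp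
  also have "\<dots> \<le> (\<Sum>i<m. (row_dot w n i z - L * row_dot w n i v)\<^sup>2)"
    by (intro sum_mono2) (auto simp: R_def Z_def)
  also note app2
  finally have cR: "card R * \<tau>\<^sup>2 \<le> 5 * L" .
  have "real (card R) \<le> m / 4"
  proof -
    \<comment> \<open>Once \<open>\<tau>\<^sup>2 \<ge> 20 * L / m\<close>, the energy
      \<open>5 * L\<close> leaves room for at most \<open>m / 4\<close> rows. This explains
      \<open>80 = 20 * 4\<close>, and \<open>exp 24\<close> offsets the squared threshold.\<close>
    have "20 * real L / m \<le> exp (- 24) * (L\<^sup>2 / (4 * K\<^sup>2) / m)"
    proof -
      have "real L * (80 * K\<^sup>2 * exp 24) \<le> real L * L" by (intro mult_left_mono K) auto
      then have "20 * real L \<le> exp (- 24) * (L\<^sup>2 / (4 * K\<^sup>2))"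
        using K by (simp add: field_simps power2_eq_square exp_minus)
      from divide_right_mono[OF this, of m] show ?thesis by simp
    qed
    also have "\<dots> \<le> \<tau>\<^sup>2" unfolding t2 by (intro mult_left_mono divide_right_mono zK) auto
    finally have "real (card R) * (20 * real L / m) \<le> card R * \<tau>\<^sup>2" by (intro mult_left_mono) auto
    with cR have "real (card R) * (20 * real L / m) \<le> 5 * L" by linarith
    then show ?thesis using m L0 by (simp add: field_simps)
  qed
  moreover have "card Z \<le> card (R \<union> small_rows m n w z)"
    using finR by (intro card_mono) (auto simp: R_def small_rows_def)
  then have "card Z \<le> card R + card (small_rows m n w z)"
    using card_Un_le order_trans by blast
  ultimately show ?thesis using small unfolding Z_def by linarith
qed

section \<open>Recovery and its measurability\<close>

definition tv :: "nat \<Rightarrow> (nat \<Rightarrow> real) \<Rightarrow> real" where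
  "tv n f = (\<Sum>i\<in>{1..<n}. step f i)"

text \<open>Signals are functions on all naturals, which suits the compactness argument below, and
  are therefore compared only below \<open>n\<close>.\<close>

definition recovers :: "nat \<Rightarrow> nat \<Rightarrow> (nat \<times> nat \<Rightarrow> real) \<Rightarrow> (nat \<Rightarrow> real) \<Rightarrow> bool" where
  "recovers m n w b \<longleftrightarrow>
    (\<forall>f. (\<forall>i<m. \<bar>row_dot w n i f\<bar> = \<bar>row_dot w n i b\<bar>) \<and> tv n f \<le> tv n b \<longrightarrow>
      (\<forall>k<n. f k = b k) \<or> (\<forall>k<n. f k = - b k))"

lemma l1_norm_discrete_grad:
  assumes "x \<in> carrier_vec n"
  shows "l1_norm (discrete_grad x) = tv n (\<lambda>k. x $ k)"
proof -
  have "l1_norm (discrete_grad x) = (\<Sum>i<n - 1. \<bar>x $ (i + 1) - x $ i\<bar>)"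
    using assms by (simp add: l1_norm_def discrete_grad_def)
  also have "\<dots> = tv n (\<lambda>k. x $ k)"
    unfolding tv_def step_def
    by (rule sum.reindex_bij_witness[of _ "\<lambda>i. i - 1" "\<lambda>i. i + 1"]) auto
  finally show ?thesis .
qed

lemma supp_discrete_grad:
  assumes "x \<in> carrier_vec n"
  shows "supp (discrete_grad x) = {i \<in> {1..<n}. step (\<lambda>k. x $ k) i \<noteq> 0}"
  using assms by (auto simp: supp_def discrete_grad_def step_def)

lemma mat_mult_row_dot:
  assumes "x \<in> carrier_vec n" "i < m"
  shows "(mat m n w *\<^sub>v x) $ i = row_dot w n i (\<lambda>k. x $ k)"
  using assms by (simp add: scalar_prod_def row_dot_def atLeast0LessThan)

lemma feasible_iff:
  assumes "x \<in> carrier_vec n" "y \<in> carrier_vec n"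
  shows "abs_vec (mat m n w *\<^sub>v x) = sqrt_vec (square_vec (abs_vec (mat m n w *\<^sub>v y)))
    \<longleftrightarrow> (\<forall>i<m. \<bar>row_dot w n i (\<lambda>k. x $ k)\<bar> = \<bar>row_dot w n i (\<lambda>k. y $ k)\<bar>)"
proof -
  have "abs_vec (mat m n w *\<^sub>v x) = sqrt_vec (square_vec (abs_vec (mat m n w *\<^sub>v y)))
    \<longleftrightarrow> (\<forall>i<m. \<bar>(mat m n w *\<^sub>v x) $ i\<bar> = \<bar>(mat m n w *\<^sub>v y) $ i\<bar>)"
    by (simp add: vec_eq_iff abs_vec_def square_vec_def sqrt_vec_def del: index_mult_mat_vec)
  then show ?thesis using assms by (simp add: mat_mult_row_dot del: index_mult_mat_vec)
qed

lemma step_uminus [simp]: "step (\<lambda>k. - f k) i = step f i"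
  by (simp add: step_def)

lemma row_dot_uminus: "row_dot w n i (\<lambda>k. - f k) = - row_dot w n i f"
  by (simp add: row_dot_def sum_negf)

lemma tv_cong: "(\<And>k. k < n \<Longrightarrow> f k = g k) \<Longrightarrow> tv n f = tv n g"
  unfolding tv_def step_def by (intro sum.cong) auto

text \<open>Both \<open>xbar\<close> and \<open>- xbar\<close> are feasible with the same objective
  value, and a feasible signal that does no worse than a minimizer is itself a minimizer.\<close>

lemma minimizers_eq_iff_recovers:
  assumes b: "xbar \<in> carrier_vec n"
  shows "tv_minimizers (mat m n w) (square_vec (abs_vec (mat m n w *\<^sub>v xbar))) = {xbar, - xbar}
    \<longleftrightarrow> recovers m n w (\<lambda>k. xbar $ k)"
proof -
  let ?b = "\<lambda>k. xbar $ k"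
  let ?P = "\<lambda>x. x \<in> carrier_vec n \<and> (\<forall>i<m. \<bar>row_dot w n i (\<lambda>k. x $ k)\<bar> = \<bar>row_dot w n i ?b\<bar>)"
  let ?g = "\<lambda>x. l1_norm (discrete_grad x)"
  have P: "x \<in> carrier_vec (dim_col (mat m n w)) \<and>
      abs_vec (mat m n w *\<^sub>v x) = sqrt_vec (square_vec (abs_vec (mat m n w *\<^sub>v xbar))) \<longleftrightarrow> ?P x" for x
    using feasible_iff[OF _ b] by auto
  have tvm: "tv_minimizers (mat m n w) (square_vec (abs_vec (mat m n w *\<^sub>v xbar))) = {x. is_arg_min ?g ?P x}"
    unfolding tv_minimizers_def P ..
  have nb: "- xbar \<in> carrier_vec n" using b by simp
  have cmb: "row_dot w n i (\<lambda>k. (- xbar) $ k) = - row_dot w n i ?b" for i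
    unfolding row_dot_uminus[symmetric] using b by (intro row_dot_cong) auto
  have "tv n (\<lambda>k. (- xbar) $ k) = tv n (\<lambda>k. - ?b k)" using b by (intro tv_cong) auto
  then have gmb: "?g (- xbar) = ?g xbar"
    by (simp add: l1_norm_discrete_grad[OF b] l1_norm_discrete_grad[OF nb]) (simp add: tv_def)
  have Pb: "?P xbar" "?P (- xbar)" using b nb by (auto simp: cmb)
  have "{x. is_arg_min ?g ?P x} = {xbar, - xbar} \<longleftrightarrow> (\<forall>x. ?P x \<and> ?g x \<le> ?g xbar \<longrightarrow> x = xbar \<or> x = - xbar)"
    (is "?A \<longleftrightarrow> ?B")
  proof
    assume A: ?A
    show ?B
    proof (intro allI impI)
      fix x assume x: "?P x \<and> ?g x \<le> ?g xbar"
      have "is_arg_min ?g ?P xbar" using A by blast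
      then have "is_arg_min ?g ?P x" using x unfolding is_arg_min_def by (meson le_less_trans not_le)
      then show "x = xbar \<or> x = - xbar" using A by blast
    qed
  next
    assume B: ?B
    have "?g xbar \<le> ?g x" if "?P x" for x
      using B that gmb by (metis (no_types, lifting) linear)
    then have "is_arg_min ?g ?P xbar" "is_arg_min ?g ?P (- xbar)"
      using Pb gmb unfolding is_arg_min_def by (force simp: not_less)+
    moreover have "x = xbar \<or> x = - xbar" if "is_arg_min ?g ?P x" for x
    proof -
      have "?P x" and "\<not> ?g xbar < ?g x" using that Pb(1) unfolding is_arg_min_def by blast+
      then show ?thesis using B by (meson not_le)
    qed
    ultimately show ?A by blast
  qed
  also have "?B \<longleftrightarrow> recovers m n w ?b" (is "?B \<longleftrightarrow> ?C")
  proof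
    assume B: ?B
    show ?C unfolding recovers_def
    proof (intro allI impI)
      fix f assume f: "(\<forall>i<m. \<bar>row_dot w n i f\<bar> = \<bar>row_dot w n i ?b\<bar>) \<and> tv n f \<le> tv n ?b"
      define x where "x = vec n f"
      have x: "x \<in> carrier_vec n" by (simp add: x_def)
      have "row_dot w n i (\<lambda>k. x $ k) = row_dot w n i f" for i
        by (rule row_dot_cong) (simp add: x_def)
      moreover have "tv n (\<lambda>k. x $ k) = tv n f" by (rule tv_cong) (simp add: x_def)
      ultimately have "?P x \<and> ?g x \<le> ?g xbar"
        using f x by (simp add: l1_norm_discrete_grad[OF b] l1_norm_discrete_grad[OF x])
      then have "x = xbar \<or> x = - xbar" using B by blast
      moreover have "x $ k = f k" if "k < n" for k using that by (simp add: x_def)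
      ultimately show "(\<forall>k<n. f k = ?b k) \<or> (\<forall>k<n. f k = - ?b k)"
        using b by (metis carrier_vecD index_uminus_vec(1))
    qed
  next
    assume C: ?C
    show ?B
    proof (intro allI impI)
      fix x assume x: "?P x \<and> ?g x \<le> ?g xbar"
      then have "(\<forall>k<n. x $ k = ?b k) \<or> (\<forall>k<n. x $ k = - ?b k)"
        using C unfolding recovers_def by (auto simp: l1_norm_discrete_grad[OF b] l1_norm_discrete_grad)
      then show "x = xbar \<or> x = - xbar"
        using x b by (auto intro!: eq_vecI)
    qed
  qed
  finally show ?thesis unfolding tvm .
qed

section \<open>Measurability of the failure event\<close>

lemma compact_box_fun: "compact {f :: nat \<Rightarrow> real. \<forall>k. \<bar>f k\<bar> \<le> c}"
proof -
  \<comment> \<open>Tychonoff's theorem for the product topology on functions.\<close>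
  have "compactin (product_topology (\<lambda>_. euclidean) UNIV) (PiE UNIV (\<lambda>_::nat. {- c..c}))"
    by (simp add: compactin_PiE)
  moreover have "PiE UNIV (\<lambda>_::nat. {- c..c}) = {f. \<forall>k. \<bar>f k\<bar> \<le> c}"
  proof -
    have "\<bar>x\<bar> \<le> c \<longleftrightarrow> x \<in> {- c..c}" for x :: real by auto
    then show ?thesis unfolding PiE_UNIV_domain Pi_def by blast
  qed
  ultimately show ?thesis by (simp add: euclidean_product_topology)
qed

text \<open>On a nonempty compact set a continuous nonnegative function has a zero as soon as its
  infimum is zero, and the infimum may be taken over a countable dense subset. This replaces an
  uncountable union by countable operations.\<close>

lemma exists_zero_event:
  fixes f :: "'w \<Rightarrow> 'a :: {metric_space, second_countable_topology} \<Rightarrow> real"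
  assumes S: "compact S"
    and cont: "\<And>w. w \<in> space M \<Longrightarrow> continuous_on S (f w)"
    and nonneg: "\<And>w x. 0 \<le> f w x"
    and meas: "\<And>x. x \<in> S \<Longrightarrow> (\<lambda>w. f w x) \<in> borel_measurable M"
  shows "{w \<in> space M. \<exists>x\<in>S. f w x = 0} \<in> sets M"
proof -
  obtain D where D: "countable D" "D \<subseteq> S" "S \<subseteq> closure D"
    using separable[of S] by metis
  have key: "(\<exists>x\<in>S. f w x = 0) \<longleftrightarrow> (\<forall>j::nat. \<exists>d\<in>D. f w d < inverse (real (Suc j)))" if w: "w \<in> space M" for w
  proof
    assume "\<exists>x\<in>S. f w x = 0"
    then obtain x where x: "x \<in> S" "f w x = 0" by blast
    show "\<forall>j::nat. \<exists>d\<in>D. f w d < inverse (real (Suc j))"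
    proof
      fix j :: nat
      obtain \<delta> where \<delta>: "\<delta> > 0" "\<And>y. y \<in> S \<Longrightarrow> dist y x < \<delta> \<Longrightarrow> dist (f w y) (f w x) < inverse (real (Suc j))"
        using cont[OF w, unfolded continuous_on_iff, rule_format, OF x(1), of "inverse (real (Suc j))"] by auto
      have "x \<in> closure D" using D x by auto
      then obtain d where d: "d \<in> D" "dist d x < \<delta>"
        using \<delta>(1) unfolding closure_approachable by blast
      then have "dist (f w d) (f w x) < inverse (real (Suc j))" using D by (intro \<delta>) auto
      then have "f w d < inverse (real (Suc j))" using x by (simp add: dist_real_def)
      then show "\<exists>d\<in>D. f w d < inverse (real (Suc j))" using d by blast
    qed
  next
    assume R: "\<forall>j::nat. \<exists>d\<in>D. f w d < inverse (real (Suc j))"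
    then have "S \<noteq> {}" using D by blast
    then obtain x where x: "x \<in> S" "\<And>y. y \<in> S \<Longrightarrow> f w x \<le> f w y"
      using continuous_attains_inf[OF S _ cont[OF w]] by blast
    have "f w x = 0"
    proof (rule ccontr)
      assume "f w x \<noteq> 0"
      then have "f w x > 0" using nonneg[of w x] by simp
      then obtain j :: nat where "inverse (real (Suc j)) < f w x"
        using reals_Archimedean by blast
      moreover obtain d where "d \<in> D" "f w d < inverse (real (Suc j))" using R by blast
      ultimately show False using x(2)[of d] D by force
    qed
    then show "\<exists>x\<in>S. f w x = 0" using x by blast
  qed
  have "{w \<in> space M. \<exists>x\<in>S. f w x = 0} = {w \<in> space M. \<forall>j::nat. \<exists>d\<in>D. f w d < inverse (real (Suc j))}"
    by (intro Collect_cong conj_cong refl key)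
  also have "\<dots> = (\<Inter>j::nat. \<Union>d\<in>D. {w \<in> space M. f w d < inverse (real (Suc j))}) \<inter> space M"
    by auto
  also have "\<dots> \<in> sets M"
  proof -
    have "{w \<in> space M. f w d < inverse (real (Suc j))} \<in> sets M" if "d \<in> D" for d and j :: nat
    proof -
      have [measurable]: "(\<lambda>w. f w d) \<in> borel_measurable M" using meas D that by blast
      show ?thesis by measurable
    qed
    then have "(\<Union>d\<in>D. {w \<in> space M. f w d < inverse (real (Suc j))}) \<in> sets M" for j :: nat
      by (intro sets.countable_UN'[OF D(1)]) auto
    then have "(\<Inter>j::nat. \<Union>d\<in>D. {w \<in> space M. f w d < inverse (real (Suc j))}) \<in> sets M"
      by (intro sets.countable_INT) auto
    then show ?thesis by (rule sets.Int) simp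
  qed
  finally show ?thesis .
qed

text \<open>Exhausts the possible failures of recovery by compact sets, which keeps the existential
  quantifier over signals measurable.\<close>

definition failures :: "nat \<Rightarrow> (nat \<Rightarrow> real) \<Rightarrow> nat \<Rightarrow> (nat \<Rightarrow> real) set" where
  "failures n b N = {f. \<forall>k. \<bar>f k\<bar> \<le> real N} \<inter>
    {f. tv n f \<le> tv n b \<and> 1 / (real N + 1) \<le> (\<Sum>k<n. \<bar>f k - b k\<bar>) \<and> 1 / (real N + 1) \<le> (\<Sum>k<n. \<bar>f k + b k\<bar>)}"

lemma continuous_on_coordinate: "continuous_on S (\<lambda>f :: nat \<Rightarrow> real. f k)"
  by (rule continuous_on_subset[OF continuous_on_product_coordinates subset_UNIV])

lemma compact_failures: "compact (failures n b N)"
  unfolding failures_def tv_def step_def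
  by (intro compact_Int_closed compact_box_fun closed_Collect_conj closed_Collect_le continuous_on_sum
      continuous_on_rabs continuous_on_diff continuous_on_add continuous_on_coordinate continuous_on_const)

lemma not_recovers_iff:
  "\<not> recovers m n w b \<longleftrightarrow>
    (\<exists>N. \<exists>f\<in>failures n b N. (\<Sum>i<m. \<bar>\<bar>row_dot w n i f\<bar> - \<bar>row_dot w n i b\<bar>\<bar>) = 0)"
proof
  assume "\<not> recovers m n w b"
  then obtain f k k' where f: "\<And>i. i < m \<Longrightarrow> \<bar>row_dot w n i f\<bar> = \<bar>row_dot w n i b\<bar>" "tv n f \<le> tv n b"
    and k: "k < n" "f k \<noteq> b k" and k': "k' < n" "f k' \<noteq> - b k'"
    unfolding recovers_def by blast
  \<comment> \<open>Cut off from \<open>n\<close> on, because \<open>failures\<close> bounds all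
    coordinates; row products and total variation do not see the change.\<close>
  define g where "g k = (if k < n then f k else 0)" for k
  define d where "d = min (\<Sum>k<n. \<bar>g k - b k\<bar>) (\<Sum>k<n. \<bar>g k + b k\<bar>)"
  have "0 < \<bar>g k - b k\<bar>" "0 < \<bar>g k' + b k'\<bar>" using k k' by (auto simp: g_def)
  then have "0 < (\<Sum>k<n. \<bar>g k - b k\<bar>)" "0 < (\<Sum>k<n. \<bar>g k + b k\<bar>)"
    using k k' by (auto intro: sum_pos2)
  then have d: "d > 0" by (simp add: d_def)
  \<comment> \<open>One \<open>N\<close> serves both as the bound on the coordinates and in the
    separation \<open>1 / (N + 1)\<close> from \<open>b\<close> and \<open>- b\<close>.\<close>
  obtain N :: nat where N: "(\<Sum>k<n. \<bar>f k\<bar>) + 1 / d < N" using reals_Archimedean2 by blast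
  have sf: "0 \<le> (\<Sum>k<n. \<bar>f k\<bar>)" by (simp add: sum_nonneg)
  have "1 / d \<le> real N + 1" using N sf by linarith
  then have "1 / (real N + 1) \<le> d" using d by (simp add: field_simps)
  moreover have "\<bar>g k\<bar> \<le> N" for k
  proof (cases "k < n")
    case True
    then have "\<bar>f k\<bar> \<le> (\<Sum>k<n. \<bar>f k\<bar>)" by (intro member_le_sum) auto
    moreover have "0 < 1 / d" using d by simp
    ultimately have "\<bar>f k\<bar> \<le> N" using N by linarith
    then show ?thesis using True by (simp add: g_def)
  qed (simp add: g_def)
  moreover have "tv n g = tv n f" by (rule tv_cong) (simp add: g_def)
  ultimately have "g \<in> failures n b N" using f by (auto simp: failures_def d_def)
  moreover have "row_dot w n i g = row_dot w n i f" for i by (rule row_dot_cong) (simp add: g_def)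
  ultimately show "\<exists>N. \<exists>f\<in>failures n b N. (\<Sum>i<m. \<bar>\<bar>row_dot w n i f\<bar> - \<bar>row_dot w n i b\<bar>\<bar>) = 0"
    using f by (intro exI[of _ N] bexI[of _ g]) auto
next
  assume "\<exists>N. \<exists>f\<in>failures n b N. (\<Sum>i<m. \<bar>\<bar>row_dot w n i f\<bar> - \<bar>row_dot w n i b\<bar>\<bar>) = 0"
  then obtain N f where f: "f \<in> failures n b N" "(\<Sum>i<m. \<bar>\<bar>row_dot w n i f\<bar> - \<bar>row_dot w n i b\<bar>\<bar>) = 0" by blast
  then have "\<forall>i<m. \<bar>row_dot w n i f\<bar> = \<bar>row_dot w n i b\<bar>" by (subst (asm) sum_nonneg_eq_0_iff) auto
  moreover have N: "0 < 1 / (real N + 1)" by simp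
  have "\<not> (\<forall>k<n. f k = b k)"
  proof
    assume "\<forall>k<n. f k = b k"
    then have "(\<Sum>k<n. \<bar>f k - b k\<bar>) = 0" by simp
    then show False using f(1) N by (simp add: failures_def)
  qed
  moreover have "\<not> (\<forall>k<n. f k = - b k)"
  proof
    assume "\<forall>k<n. f k = - b k"
    then have "(\<Sum>k<n. \<bar>f k + b k\<bar>) = 0" by simp
    then show False using f(1) N by (simp add: failures_def)
  qed
  ultimately show "\<not> recovers m n w b" using f(1) unfolding recovers_def failures_def by blast
qed

lemma not_recovers_event:
  "{w \<in> space (gaussian_entries m n). \<not> recovers m n w b} \<in> sets (gaussian_entries m n)"
proof -
  let ?M = "gaussian_entries m n"
  let ?F = "\<lambda>w f. \<Sum>i<m. \<bar>\<bar>row_dot w n i f\<bar> - \<bar>row_dot w n i b\<bar>\<bar>"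
  have "{w \<in> space ?M. \<exists>f\<in>failures n b N. ?F w f = 0} \<in> sets ?M" for N
  proof (rule exists_zero_event[OF compact_failures])
    show "continuous_on (failures n b N) (?F w)" for w
      unfolding row_dot_def by (intro continuous_on_sum continuous_on_rabs continuous_on_diff continuous_on_mult
          continuous_on_coordinate continuous_on_const)
    show "(\<lambda>w. ?F w f) \<in> borel_measurable ?M" for f
      by (intro borel_measurable_sum borel_measurable_abs borel_measurable_diff row_dot_measurable) auto
  qed (simp add: sum_nonneg)
  then have "(\<Union>N. {w \<in> space ?M. \<exists>f\<in>failures n b N. ?F w f = 0}) \<in> sets ?M" by blast
  also have "(\<Union>N. {w \<in> space ?M. \<exists>f\<in>failures n b N. ?F w f = 0}) = {w \<in> space ?M. \<not> recovers m n w b}"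
    unfolding not_recovers_iff by blast
  finally show ?thesis .
qed

section \<open>Descent cone and deterministic recovery\<close>

context separated_jumps
begin

text \<open>Off \<open>T\<close> the signal \<open>b\<close> is flat, so \<open>f - b\<close> has
  the steps of \<open>f\<close>; on \<open>T\<close> the triangle inequality compares the steps of
  \<open>b\<close> with those of \<open>f - b\<close> and \<open>f\<close>.\<close>

lemma descent_cone:
  assumes flat: "\<And>i. i \<in> {1..<n} - T \<Longrightarrow> step b i = 0" and f: "tv n f \<le> tv n b"
  shows "(\<Sum>i\<in>{1..<n} - T. step (\<lambda>k. f k - b k) i) \<le> (\<Sum>i\<in>T. step (\<lambda>k. f k - b k) i)"
proof -
  have split: "tv n g = (\<Sum>i\<in>{1..<n} - T. step g i) + (\<Sum>i\<in>T. step g i)" for g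
    unfolding tv_def by (rule sum.subset_diff[OF T_subset]) simp
  have "(\<Sum>i\<in>{1..<n} - T. step (\<lambda>k. f k - b k) i) = (\<Sum>i\<in>{1..<n} - T. step f i)"
  proof (rule sum.cong[OF refl])
    fix i assume "i \<in> {1..<n} - T"
    from flat[OF this] have "b i = b (i - 1)" by (simp add: step_def)
    then show "step (\<lambda>k. f k - b k) i = step f i" by (simp add: step_def)
  qed
  moreover have "(\<Sum>i\<in>{1..<n} - T. step b i) = 0" using flat by simp
  moreover have "(\<Sum>i\<in>T. step b i) \<le> (\<Sum>i\<in>T. step (\<lambda>k. f k - b k) i + step f i)"
  proof (rule sum_mono)
    fix i show "step b i \<le> step (\<lambda>k. f k - b k) i + step f i" unfolding step_def by linarith
  qed
  ultimately show ?thesis using f split[of f] split[of b] by (simp add: sum.distrib)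
qed

lemma recovery_of_good_entries:
  assumes n: "n > 0" and m: "m > 0" and flat: "\<And>i. i \<in> {1..<n} - T \<Longrightarrow> step b i = 0"
    and good: "good_entries m n grid L w"
    and K: "K > 0" "sqrt (card grid) + 2 * sqrt (2 * card T * harm l) \<le> K" "80 * K\<^sup>2 * exp 24 \<le> L"
  shows "recovers m n w b"
  unfolding recovers_def
proof (intro allI impI)
  fix f assume f: "(\<forall>i<m. \<bar>row_dot w n i f\<bar> = \<bar>row_dot w n i b\<bar>) \<and> tv n f \<le> tv n b"
  define Z where "Z u = {i. i < m \<and> row_dot w n i u = 0}" for u
  \<comment> \<open>Stated for a general \<open>c\<close> because it is applied to \<open>b\<close>
    and to \<open>- b\<close>, which have the same steps.\<close>
  have few: "real (card (Z (\<lambda>k. f k - c k))) < m / 2"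
    if flat_c: "\<And>i. i \<in> {1..<n} - T \<Longrightarrow> step c i = 0" and tv_c: "tv n f \<le> tv n c"
      and k: "k < n" "f k \<noteq> c k" for c k
  proof -
    let ?u = "\<lambda>k. f k - c k"
    have "sqnorm {..<n} ?u > 0" unfolding sqnorm_def using k by (intro sum_pos2[of _ k]) auto
    moreover have "(\<Sum>i<n. \<bar>run_coeff grid ?u i\<bar> * sqrt (card (run n grid i))) \<le> K * sqrt (sqnorm {..<n} ?u)"
    proof (rule order_trans)
      show "(\<Sum>i<n. \<bar>run_coeff grid ?u i\<bar> * sqrt (card (run n grid i)))
      \<le> (sqrt (card grid) + 2 * sqrt (2 * card T * harm l)) * sqrt (sqnorm {..<n} ?u)"
        by (rule grid_l1_bound[OF n descent_cone[OF flat_c tv_c]])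
    qed (use K(2) in \<open>auto intro: mult_right_mono\<close>)
    moreover have "0 \<in> grid" using n by (simp add: grid_def)
    ultimately show ?thesis unfolding Z_def
      by (intro few_zero_rows[OF _ n m good K(1,3)]) auto
  qed
  show "(\<forall>k<n. f k = b k) \<or> (\<forall>k<n. f k = - b k)"
  proof (rule ccontr)
    assume "\<not> ?thesis"
    then obtain k k' where k: "k < n" "f k \<noteq> b k" and k': "k' < n" "f k' \<noteq> - b k'" by blast
    have 1: "real (card (Z (\<lambda>k. f k - b k))) < m / 2"
      by (rule few[where c = b, OF flat conjunct2[OF f] k])
    have 2: "real (card (Z (\<lambda>k. f k - - b k))) < m / 2"
    proof (rule few[where c = "\<lambda>k. - b k", OF _ _ k'])
      show "step (\<lambda>k. - b k) i = 0" if "i \<in> {1..<n} - T" for i using flat[OF that] by simp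
      show "tv n f \<le> tv n (\<lambda>k. - b k)" using conjunct2[OF f] by (simp add: tv_def)
    qed
    \<comment> \<open>Equal moduli make every row annihilate \<open>f - b\<close> or
      \<open>f + b\<close>, but two sets of fewer than \<open>m / 2\<close> rows cannot cover all
      \<open>m\<close>.\<close>
    have "{..<m} \<subseteq> Z (\<lambda>k. f k - b k) \<union> Z (\<lambda>k. f k - - b k)"
    proof
      fix i assume i: "i \<in> {..<m}"
      have "row_dot w n i (\<lambda>k. f k - b k) = row_dot w n i f - row_dot w n i b"
        "row_dot w n i (\<lambda>k. f k - - b k) = row_dot w n i f + row_dot w n i b"
        by (simp_all add: row_dot_def algebra_simps sum.distrib sum_subtractf)
      moreover have "\<bar>row_dot w n i f\<bar> = \<bar>row_dot w n i b\<bar>" using f i by auto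
      ultimately show "i \<in> Z (\<lambda>k. f k - b k) \<union> Z (\<lambda>k. f k - - b k)"
        using i by (auto simp: Z_def abs_eq_iff)
    qed
    then have "card {..<m} \<le> card (Z (\<lambda>k. f k - b k) \<union> Z (\<lambda>k. f k - - b k))"
      by (intro card_mono) (auto simp: Z_def)
    also have "\<dots> \<le> card (Z (\<lambda>k. f k - b k)) + card (Z (\<lambda>k. f k - - b k))" by (rule card_Un_le)
    finally show False using 1 2 by simp
  qed
qed

end

section \<open>Parameters and probability of recovery\<close>

text \<open>Consecutive entries of the jump list are at least \<open>2 * l\<close> apart. The list
  includes the ends \<open>0\<close> and \<open>n\<close>, so one gap estimate gives both the bounds
  and the mutual distances.\<close>

lemma separated_jumps_of_separation_constant:
  assumes x: "xbar \<in> carrier_vec n" and s: "card (supp (discrete_grad xbar)) = s" "s \<ge> 1"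
    and sep: "has_separation_constant xbar \<Delta>"
    and l: "l \<ge> 1" "2 * real l \<le> \<Delta> * n / (s + 1)"
  shows "separated_jumps n l (supp (discrete_grad xbar))"
proof -
  define T where "T = supp (discrete_grad xbar)"
  define J where "J = jump_list xbar"
  define ts where "ts = sorted_list_of_set T"
  have T: "T \<subseteq> {1..<n}" "finite T" unfolding T_def supp_discrete_grad[OF x] by auto
  then have n: "n > 0" using s by (cases n) (auto simp: T_def)
  have ts: "sorted ts" "distinct ts" "set ts = T" "length ts = s"
    using T s by (auto simp: ts_def T_def)
  have J: "J = 0 # ts @ [n]" using x by (simp add: J_def jump_list_def ts_def T_def)
  have sortedJ: "sorted J" unfolding J using ts T by (auto simp: sorted_append)
  have lenJ: "length J = s + 2" using ts by (simp add: J)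
  have gap: "J ! j + 2 * l \<le> J ! (j + 1)" if "j \<le> s" for j
  proof -
    have "\<Delta> / (s + 1) \<le> (MIN j\<in>{1..s + 1}. \<bar>real (J ! j) - real (J ! (j - 1))\<bar> / n)"
      using sep x s unfolding has_separation_constant_def J_def Let_def by simp
    also have "\<dots> \<le> \<bar>real (J ! (j + 1)) - real (J ! (j + 1 - 1))\<bar> / n"
      using that by (intro Min_le finite_imageI imageI) auto
    finally have "\<Delta> * n / (s + 1) \<le> \<bar>real (J ! (j + 1)) - real (J ! j)\<bar>"
      using n by (simp add: field_simps)
    moreover have "J ! j \<le> J ! (j + 1)"
      using that lenJ by (intro sorted_nth_mono[OF sortedJ]) auto
    ultimately show ?thesis using l by linarith
  qed
  have idx: "\<exists>a<s. t = J ! (a + 1)" if t: "t \<in> T" for t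
  proof -
    obtain a where "a < length ts" "t = ts ! a" using t ts(3) by (metis in_set_conv_nth)
    then show ?thesis using ts(4) by (auto simp: J nth_append)
  qed
  show ?thesis unfolding T_def[symmetric]
  proof
    show "1 \<le> l" by (rule l)
    fix t assume "t \<in> T"
    then obtain a where a: "a < s" "t = J ! (a + 1)" using idx by blast
    have "J ! (a + 2) \<le> J ! (s + 1)" using a lenJ by (intro sorted_nth_mono[OF sortedJ]) auto
    also have "J ! (s + 1) = n" using ts by (simp add: J nth_append)
    finally show "l \<le> t \<and> t + l \<le> n" using a gap[of a] gap[of "a + 1"] by simp
  next
    fix t t' assume tt: "t \<in> T" "t' \<in> T" "t < t'"
    obtain a where a: "a < s" "t = J ! (a + 1)" using idx tt by blast
    obtain a' where a': "a' < s" "t' = J ! (a' + 1)" using idx tt by blast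
    have "a < a'"
    proof (rule ccontr)
      assume "\<not> a < a'"
      then have "t' \<le> t" unfolding a a' using a lenJ by (intro sorted_nth_mono[OF sortedJ]) auto
      then show False using tt by simp
    qed
    then have "J ! (a + 2) \<le> J ! (a' + 1)" using a' lenJ by (intro sorted_nth_mono[OF sortedJ]) auto
    then show "t + 2 * l \<le> t'" using gap[of "a + 1"] a a' by simp
  qed
qed

lemma harm_le_ln: "l \<ge> 1 \<Longrightarrow> harm l \<le> 1 + ln (real l)"
proof -
  assume "l \<ge> 1"
  then obtain k where k: "l = Suc k" by (cases l) auto
  have "harm (Suc k) - ln (real (Suc k)) \<le> harm (Suc 0) - ln (real (Suc 0))"
    using decseq_harm_diff_ln unfolding decseq_def by blast
  then show ?thesis by (simp add: k harm_def)
qed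

lemma ln_2_ge_half: "ln 2 \<ge> (1 / 2 :: real)"
proof -
  have "exp (1 / 2) \<le> (2 :: real)"
  proof (rule power2_le_imp_le)
    show "(exp (1 / 2))\<^sup>2 \<le> (2 :: real)\<^sup>2" using exp_le by (simp add: exp_double[symmetric])
  qed simp
  then show ?thesis by (subst ln_ge_iff) simp_all
qed

lemma card_exponents:
  assumes n: "n \<ge> 2"
  shows "real (card {a. (2::nat) ^ a < n}) \<le> 1 + 2 * ln (real n)"
proof -
  have l0: "0 \<le> ln (real n)" using n by simp
  have "{a. (2::nat) ^ a < n} \<subseteq> {..nat \<lfloor>2 * ln (real n)\<rfloor>}"
  proof
    fix a assume "a \<in> {a. (2::nat) ^ a < n}"
    then have "2 ^ a < n" by simp
    then have "real (2 ^ a) < real n" by (simp only: of_nat_less_iff)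
    then have "ln (2 ^ a) < ln (real n)" by simp
    then have "real a * ln 2 < ln (real n)" by (simp add: ln_realpow)
    moreover have "real a * (1 / 2) \<le> real a * ln 2" by (intro mult_left_mono ln_2_ge_half) simp
    ultimately have "real a \<le> 2 * ln (real n)" by simp
    then show "a \<in> {..nat \<lfloor>2 * ln (real n)\<rfloor>}" by (simp add: le_nat_floor)
  qed
  then have "card {a. (2::nat) ^ a < n} \<le> card {..nat \<lfloor>2 * ln (real n)\<rfloor>}" by (intro card_mono) auto
  then have "real (card {a. (2::nat) ^ a < n}) \<le> real (nat \<lfloor>2 * ln (real n)\<rfloor>) + 1" by simp
  also have "real (nat \<lfloor>2 * ln (real n)\<rfloor>) \<le> 2 * ln (real n)" using l0 by (simp add: of_nat_nat)
  finally show ?thesis by simp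
qed

context separated_jumps
begin

text \<open>The single parameter \<open>r\<close> dominates all sizes involved:
  \<open>s \<le> 8 * r\<close>, \<open>s * ln n \<le> 4 * r\<close> and
  \<open>n div l \<le> 16 * r\<close>. The last rests on the lower bound for \<open>l\<close>, the
  first two on \<open>\<Delta> \<le> 4\<close>.\<close>

lemma grid_width_bound:
  fixes s :: nat and \<Delta> :: real
  assumes s: "card T = s" "s \<ge> 1" and D: "\<Delta> > 0" and l: "\<Delta> * n / (4 * (s + 1)) \<le> l"
  defines "r \<equiv> s * ln (real n) / \<Delta>"
  shows "sqrt (card grid) + 2 * sqrt (2 * card T * harm l) \<le> 20 * sqrt r" "1 / 8 \<le> r" "ln (real n) \<le> 4 * r"
proof -
  have "2 * 1 * 1 \<le> 2 * l * card T" using l_pos s by (intro mult_le_mono) auto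
  then have n: "n \<ge> 2" using card_T_bound by linarith
  define lam where "lam = ln (real n)"
  have "ln 2 \<le> lam" unfolding lam_def using n by simp
  then have lam: "lam \<ge> 1 / 2" using ln_2_ge_half by linarith
  \<comment> \<open>A packing argument for \<open>\<Delta> \<le> 4\<close>: the disjoint windows fit
    into \<open>n\<close> points, while \<open>l\<close> is at least
    \<open>\<Delta> * n / (4 * (s + 1))\<close>.\<close>
  have "real (2 * l * card T) \<le> n" by (intro of_nat_mono card_T_bound)
  then have "2 * real l * s \<le> n" by (simp add: s)
  moreover have "2 * (\<Delta> * n / (4 * (s + 1))) * s \<le> 2 * real l * s"
    using l by (intro mult_right_mono mult_left_mono) auto
  ultimately have "2 * (\<Delta> * n / (4 * (s + 1))) * s \<le> n" by linarith
  then have "\<Delta> * s * n \<le> 2 * (real s + 1) * n" by (simp add: field_simps)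
  then have "\<Delta> * s \<le> 2 * (real s + 1)" using n by (subst (asm) mult_le_cancel_right_pos) auto
  also have "\<dots> \<le> 4 * real s" using s by simp
  finally have D4: "\<Delta> \<le> 4" using s by simp
  have r: "r * \<Delta> = s * lam" using D by (simp add: r_def lam_def)
  have r0: "r \<ge> 0" using D lam by (auto simp: r_def lam_def[symmetric])
  have sl: "s * lam \<le> 4 * r"
  proof -
    have "r * \<Delta> \<le> r * 4" using r0 D4 by (intro mult_left_mono) auto
    then show ?thesis using r by simp
  qed
  have "real s * (1 / 2) \<le> s * lam" by (intro mult_left_mono lam) simp
  then have s8: "s \<le> 8 * r" using sl by simp
  show "1 / 8 \<le> r" using s8 s by simp
  have "1 * lam \<le> s * lam" using s lam by (intro mult_right_mono) auto
  then show "ln (real n) \<le> 4 * r" using sl by (simp add: lam_def)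
  have sD: "s / \<Delta> \<le> 2 * r"
  proof -
    have "s / \<Delta> * (1 / 2) \<le> s / \<Delta> * lam" using D by (intro mult_left_mono lam) auto
    then show ?thesis by (simp add: r_def lam_def)
  qed
  have nl: "real (n div l) \<le> 16 * r"
  proof -
    have "real (n div l * l) \<le> n" by (intro of_nat_mono div_times_less_eq_dividend)
    then have "real (n div l) \<le> n / l" using l_pos by (simp add: field_simps)
    also have "\<dots> \<le> n / (\<Delta> * n / (4 * (s + 1)))"
      using l D n l_pos by (intro divide_left_mono mult_pos_pos divide_pos_pos) auto
    also have "\<dots> = 4 * (s + 1) / \<Delta>" using D n by (simp add: field_simps)
    also have "\<dots> \<le> 4 * (2 * s) / \<Delta>" using s D by (intro divide_right_mono) auto
    also have "\<dots> = 8 * (s / \<Delta>)" by simp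
    finally show ?thesis using sD by linarith
  qed
  have "real (card grid) \<le> real (1 + card T + 2 * (card T * card {a. (2::nat) ^ a < n}) + (n div l + 1))"
    by (intro of_nat_mono card_grid)
  also have "\<dots> = 2 + s + 2 * (s * real (card {a. (2::nat) ^ a < n})) + real (n div l)"
    by (simp add: s)
  also have "real s * real (card {a. (2::nat) ^ a < n}) \<le> s * (1 + 2 * lam)"
    unfolding lam_def by (intro mult_left_mono card_exponents n) simp
  finally have "real (card grid) \<le> 2 + s + 2 * (s * (1 + 2 * lam)) + 16 * r" using nl by linarith
  also have "\<dots> = 2 + 3 * s + 4 * (s * lam) + 16 * r" by (simp add: algebra_simps)
  \<comment> \<open>The four terms are at most 16, 24, 16 and 16 times \<open>r\<close>; their sum
    72 is rounded up to the square 81. The final 20 bounds \<open>9 + 2 * 5\<close>.\<close>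
  also have "\<dots> \<le> 81 * r" using s s8 sl by linarith
  finally have "sqrt (card grid) \<le> sqrt (9\<^sup>2 * r)" by simp
  then have 1: "sqrt (card grid) \<le> 9 * sqrt r" by (simp add: real_sqrt_mult)
  have "l \<le> n"
  proof -
    have "l * 1 \<le> l * (2 * s)" using s by (intro mult_le_mono2) simp
    also have "\<dots> \<le> n" using card_T_bound s by (simp add: mult_ac)
    finally show ?thesis by simp
  qed
  then have "harm l \<le> 1 + lam" unfolding lam_def using l_pos
    by (intro order_trans[OF harm_le_ln]) auto
  then have "s * harm l \<le> s * (1 + lam)" by (intro mult_left_mono) auto
  also have "\<dots> = s + s * lam" by (simp add: algebra_simps)
  finally have "2 * s * harm l \<le> 25 * r" using s8 sl r0 by linarith
  then have "sqrt (2 * card T * harm l) \<le> sqrt (5\<^sup>2 * r)" using s by simp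
  then have 2: "sqrt (2 * card T * harm l) \<le> 5 * sqrt r" by (simp add: real_sqrt_mult)
  show "sqrt (card grid) + 2 * sqrt (2 * card T * harm l) \<le> 20 * sqrt r"
    using 1 2 real_sqrt_ge_zero[OF r0] by linarith
qed

end

text \<open>Each of the two terms is at most \<open>exp (- m / 4)\<close>, and
  \<open>nu\<^sup>2 / 16\<close> is below \<open>1 / 4\<close>.\<close>

lemma failure_probability:
  fixes m n L :: nat
  assumes n: "n \<ge> 2" and m: "4 * ln (real n) \<le> m" and L: "2 * L * ln (real n) \<le> m"
  shows "n * exp (- (real m / 2)) + (2 * real n) ^ L * exp (- (2 * real m)) \<le> 3 * exp (- (nu\<^sup>2 * m / 16))"
proof -
  have "n * exp (- (real m / 2)) = exp (ln n) * exp (- (real m / 2))" using n by simp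
  also have "\<dots> = exp (ln n - real m / 2)" unfolding exp_add[symmetric] by simp
  also have "\<dots> \<le> exp (- (real m / 4))" using m by simp
  finally have 1: "n * exp (- (real m / 2)) \<le> exp (- (real m / 4))" .
  have "ln (2 * real n) \<le> 2 * ln n" using n by (simp add: ln_mult)
  then have "real L * ln (2 * real n) \<le> L * (2 * ln n)" by (intro mult_left_mono) auto
  then have "real L * ln (2 * real n) \<le> m" using L by simp
  moreover have "(2 * real n) ^ L = exp (real L * ln (2 * real n))" using n by (simp add: exp_of_nat_mult)
  ultimately have "(2 * real n) ^ L * exp (- (2 * real m)) \<le> exp (real m) * exp (- (2 * real m))" by simp
  also have "\<dots> \<le> exp (- (real m / 4))" unfolding exp_add[symmetric] by simp
  finally have 2: "(2 * real n) ^ L * exp (- (2 * real m)) \<le> exp (- (real m / 4))" .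
  have "nu\<^sup>2 = pi / 648" by (simp add: nu_def power_mult_distrib power_divide)
  then have "nu\<^sup>2 / 16 \<le> 1 / 4" using pi_less_4 by simp
  then have "nu\<^sup>2 / 16 * m \<le> 1 / 4 * m" by (intro mult_right_mono) auto
  then have "exp (- (real m / 4)) \<le> exp (- (nu\<^sup>2 * m / 16))" by simp
  moreover have "0 < exp (- (nu\<^sup>2 * m / 16))" by simp
  ultimately show ?thesis using 1 2 by linarith
qed

lemma recovery_probability:
  fixes n m s :: nat
  assumes x: "xbar \<in> carrier_vec n" and s: "s \<ge> 1" "card (supp (discrete_grad xbar)) = s"
    and sep: "has_separation_constant xbar \<Delta>" and Dn: "\<Delta> \<ge> 8 * real s / real n"
    and m: "real m \<ge> (66000 * exp 24) / \<Delta> * real s * (ln (real n))\<^sup>2"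
  shows "\<P>(\<omega> in gaussian_entries m n.
      tv_minimizers (mat m n \<omega>) (square_vec (abs_vec (mat m n \<omega> *\<^sub>v xbar))) = {xbar, - xbar})
    \<ge> 1 - 3 * exp (- (nu\<^sup>2 * real m / 16))"
proof -
  let ?M = "gaussian_entries m n" and ?b = "\<lambda>k. xbar $ k"
  define T where "T = supp (discrete_grad xbar)"
  have Teq: "T = {i \<in> {1..<n}. step ?b i \<noteq> 0}" unfolding T_def by (rule supp_discrete_grad[OF x])
  have "T \<noteq> {}" using s unfolding T_def by auto
  then have n: "n \<ge> 2" unfolding Teq by force
  have D: "\<Delta> > 0" using sep by (simp add: has_separation_constant_def)
  \<comment> \<open>Half of the guaranteed gap. The assumption
    \<open>\<Delta> \<ge> 8 * s / n\<close> gives \<open>y \<ge> 2\<close>, so rounding down loses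
    at most a factor of two.\<close>
  define y where "y = \<Delta> * n / (2 * (s + 1))"
  define l where "l = nat \<lfloor>y\<rfloor>"
  have "8 * real s \<le> \<Delta> * n" using Dn n by (simp add: field_simps)
  then have y2: "2 \<le> y" unfolding y_def using s by (simp add: field_simps)
  have ly: "real l \<le> y" "y < real l + 1" unfolding l_def using y2 by linarith+
  have l1: "l \<ge> 1" using ly y2 by linarith
  have "separated_jumps n l T" unfolding T_def
    using ly(1) by (intro separated_jumps_of_separation_constant[OF x s(2,1) sep l1]) (simp add: y_def field_simps)
  then interpret separated_jumps n l T .
  define r where "r = s * ln (real n) / \<Delta>"
  have "\<Delta> * n / (4 * (s + 1)) = y / 2" by (simp add: y_def field_simps)
  also have "\<dots> \<le> l" using ly y2 by linarith
  finally have l4: "\<Delta> * n / (4 * (s + 1)) \<le> l" .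
  note width = grid_width_bound[OF s(2)[folded T_def] s(1) D l4, folded r_def]
  have r0: "r > 0" using width(2) by linarith
  \<comment> \<open>\<open>32000 = 80 * 20\<^sup>2\<close>, the requirement of
    \<open>few_zero_rows\<close> for \<open>K = 20 * sqrt r\<close>.\<close>
  define L where "L = nat \<lceil>32000 * r * exp 24\<rceil>"
  have L: "32000 * r * exp 24 \<le> L" "L \<le> 32000 * r * exp 24 + 1"
    unfolding L_def using r0 by (auto simp: of_nat_ceiling intro: less_imp_le)
  have m': "66000 * exp 24 * (r * ln (real n)) \<le> m"
    using m by (simp add: r_def power2_eq_square mult_ac)
  have ln0: "ln (real n) > 0" using n by simp
  have e1: "(1::real) \<le> exp 24" by simp
  have "1 / 8 * ln (real n) \<le> r * ln (real n)" using width(2) ln0 by (intro mult_right_mono) auto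
  moreover have "66000 * 1 * (r * ln (real n)) \<le> 66000 * exp 24 * (r * ln (real n))"
    using e1 r0 ln0 by (intro mult_right_mono) auto
  ultimately have m4: "4 * ln (real n) \<le> m" using m' ln0 by linarith
  have m0: "m > 0" using m4 ln0 by (cases m) auto
  have Lm: "2 * L * ln (real n) \<le> m"
  proof -
    \<comment> \<open>Since \<open>r * exp 24 \<ge> 1 / 8\<close>, rounding up costs at most
      \<open>1000 * r * exp 24\<close>. Doubling 33000 yields the constant 66000.\<close>
    have "1 / 8 * 1 \<le> r * exp 24" using width(2) e1 by (intro mult_mono) auto
    then have "L \<le> 33000 * (r * exp 24)" using L(2) by linarith
    then have "2 * L * ln (real n) \<le> 2 * (33000 * (r * exp 24)) * ln (real n)"
      using ln0 by (intro mult_right_mono) auto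
    also have "\<dots> = 66000 * exp 24 * (r * ln (real n))" by simp
    finally show ?thesis using m' by linarith
  qed
  interpret prob_space ?M by (rule prob_space_gaussian_entries[OF m0])
  let ?bad = "{w \<in> space ?M. \<not> recovers m n w ?b}"
  have "prob ?bad \<le> prob {w \<in> space ?M. \<not> good_entries m n grid L w}"
  proof (intro finite_measure_mono not_good_entries_event subsetI)
    fix w assume "w \<in> ?bad"
    moreover have "recovers m n w ?b" if "good_entries m n grid L w"
    proof (rule recovery_of_good_entries[OF _ m0 _ that])
      show "sqrt (card grid) + 2 * sqrt (2 * card T * harm l) \<le> 20 * sqrt r" by (rule width(1))
      show "80 * (20 * sqrt r)\<^sup>2 * exp 24 \<le> L" using L(1) r0 by (simp add: power_mult_distrib)
    qed (use n r0 Teq in auto)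
    ultimately show "w \<in> {w \<in> space ?M. \<not> good_entries m n grid L w}" by blast
  qed
  also have "\<dots> \<le> n * exp (- (real m / 2)) + (2 * real n) ^ L * exp (- (2 * real m))"
    by (rule prob_not_good_entries[OF m0])
  also have "\<dots> \<le> 3 * exp (- (nu\<^sup>2 * m / 16))"
    by (rule failure_probability[OF n m4 Lm])
  finally have bad: "prob ?bad \<le> 3 * exp (- (nu\<^sup>2 * m / 16))" .
  have "{w \<in> space ?M. recovers m n w ?b} = space ?M - ?bad" by auto
  then have "prob {w \<in> space ?M. recovers m n w ?b} = 1 - prob ?bad"
    using prob_compl[OF not_recovers_event[of m n ?b]] by simp
  then show ?thesis using bad by (simp add: minimizers_eq_iff_recovers[OF x])
qed

theorem proposition3p21:
  shows "\<exists>C>0. \<forall>(n::nat) (m::nat) (s::nat) (\<Delta>::real). \<forall>xbar \<in> carrier_vec n.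
    s \<ge> 1 \<longrightarrow>
    card (supp (discrete_grad xbar)) = s \<longrightarrow>
    has_separation_constant xbar \<Delta> \<longrightarrow>
    \<Delta> \<ge> 8 * real s / real n \<longrightarrow>
    real m \<ge> C / \<Delta> * real s * (ln (real n))\<^sup>2 \<longrightarrow>
    \<P>(\<omega> in gaussian_entries m n.
        tv_minimizers (mat m n \<omega>) (square_vec (abs_vec (mat m n \<omega> *\<^sub>v xbar))) = {xbar, - xbar})
      \<ge> 1 - 3 * exp (- (nu\<^sup>2 * real m / 16))"
  by (intro exI[of _ "66000 * exp 24"] conjI allI ballI impI recovery_probability) auto

end
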